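(* Let $\mathcal N=\mathbb R\setminus\mathcal B$ be the set of non-Brjuno real numbers, and let $J\subset\mathbb R$ be a nondegenerate interval. (i) For every $0<\delta\le 2$, $$\mathcal H^{h_\delta}(\mathcal N\cap J)=\infty.$$ (ii) For every $\delta>2$, $$\mathcal H^{h_\delta}(\mathcal N)=0.$$ (iii) The critical exponent for logarithmic capacity is $2$; more precisely, $$\operatorname{Cap}_s(\mathcal N\cap J)>0\quad\text{for } 0<s\le 2,\qquad \operatorname{Cap}_s(\mathcal N\cap J)=0\quad\text{for } s>2.$$ Consequently, $$\operatorname{Cap}_2(\mathcal N)>0,\qquad \dim_{\mathrm{cap}}(\mathcal N\cap J)=\dim_{\mathrm{cap}}\mathcal N=2.$$
   Context: Brjuno numbers: for an irrational $\alpha=[a_0;a_1,a_2,\ldots]$, let $P_n/Q_n=[a_0;a_1,\ldots,a_n]$ ($n\ge 0$) be its continued-fraction convergents in reduced form. The irrational $\alpha$ is a Brjuno number if $\sum_{n=0}^\infty \frac{\log Q_{n+1}}{Q_n}<\infty$. $\mathcal B$ denotes the set of Brjuno irrational numbers, and $\mathcal N:=\mathbb R\setminus\mathcal B$ (so $\mathcal N$ contains all rationals). Gauges: for $\delta>0$, $h_\delta(0):=0$, $h_\delta(r):=(\log(1/r))^{-\delta}$ for $0<r<1/e$, and $h_\delta(r):=1$ for $r\ge 1/e$. Hausdorff measure: for a dimension function $h$ (continuous, nondecreasing $h:[0,\infty)\to[0,\infty)$ with $h(0)=0$), a set $E\subset\mathbb R$ and $\varepsilon>0$, $\mathcal H^h(E,\varepsilon)$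 is the infimum of $\sum_j h(r_j)$ over all finite or countable covers of $E$ by open balls $B(x_j,r_j)=(x_j-r_j,x_j+r_j)$ with $r_j<\varepsilon$; and $\mathcal H^h(E):=\lim_{\varepsilon\to0+}\mathcal H^h(E,\varepsilon)$. Logarithmic capacity: for $s>0$ and $z,w\in\mathbb C$ let $k_s(z,w):=(h_1(|z-w|))^{-s}$ (equal to $+\infty$ if $z=w$). For compact $K\subset\mathbb C$ let $\mathcal P(K)$ be the set of Borel probability measures supported on $K$, let $I_s(\mu):=\iint k_s(z,w)\,d\mu(z)\,d\mu(w)$ for $\mu\in\mathcal P(K)$, and $\operatorname{Cap}_s(K):=\left(\inf_{\mu\in\mathcal P(K)}I_s(\mu)\right)^{-1}$ (with $1/\infty=0$). For arbitrary $E\subset\mathbb C$, $\operatorname{Cap}_s(E):=\sup\{\operatorname{Cap}_s(K):K\subset E,\ K\text{ compact}\}$. Subsets of $\mathbb R$ are regarded as subsets of $\mathbb C$. The capacity dimension is $\dim_{\mathrm{cap}}E:=\sup\{s>0:\operatorname{Cap}_s(E)>0\}$. *)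

theory Defs
  imports "HOL-Probability.Probability"
begin

section \<open>Continued fractions and Brjuno numbers\<close>

fun cf_complete_quotient :: "real \<Rightarrow> nat \<Rightarrow> real" where
  "cf_complete_quotient x 0 = x"
| "cf_complete_quotient x (Suc n) = 1 / frac (cf_complete_quotient x n)"

definition cf_partial_quotient :: "real \<Rightarrow> nat \<Rightarrow> int" where
  "cf_partial_quotient x n = \<lfloor>cf_complete_quotient x n\<rfloor>"

text \<open>The value \<open>[a\<^sub>0; a\<^sub>1, \<dots>, a\<^sub>n]\<close>; the empty list is a dummy case.\<close>
fun finite_cf :: "int list \<Rightarrow> rat" where
  "finite_cf [] = 0"
| "finite_cf [a] = of_int a"
| "finite_cf (a # b # as) = of_int a + 1 / finite_cf (b # as)"

definition cf_convergent :: "real \<Rightarrow> nat \<Rightarrow> rat" where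
  "cf_convergent x n = finite_cf (map (cf_partial_quotient x) [0..<Suc n])"

text \<open>\<^const>\<open>quotient_of\<close> yields the reduced fraction with positive denominator.\<close>
definition cf_denom :: "real \<Rightarrow> nat \<Rightarrow> int" where
  "cf_denom x n = snd (quotient_of (cf_convergent x n))"

definition brjuno :: "real set" where
  "brjuno = {x. x \<notin> \<rat> \<and>
     summable (\<lambda>n. ln (real_of_int (cf_denom x (Suc n))) / real_of_int (cf_denom x n))}"

definition non_brjuno :: "real set" where
  "non_brjuno = UNIV - brjuno"

section \<open>Gauges and Hausdorff measures\<close>

text \<open>Only arguments \<open>r \<ge> 0\<close> matter.\<close>
definition log_gauge :: "real \<Rightarrow> real \<Rightarrow> real" where
  "log_gauge \<delta> r =
     (if r \<le> 0 then 0 else if r < 1 / exp 1 then ln (1 / r) powr (- \<delta>) else 1)"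

text \<open>Finite and countable covers are both families indexed by a set of natural numbers.\<close>
definition hausdorff_content :: "(real \<Rightarrow> real) \<Rightarrow> real set \<Rightarrow> real \<Rightarrow> ennreal" where
  "hausdorff_content h E \<epsilon> =
     (INF (I, x, r) \<in> {(I :: nat set, x :: nat \<Rightarrow> real, r :: nat \<Rightarrow> real).
          (\<forall>j\<in>I. 0 < r j \<and> r j < \<epsilon>) \<and> E \<subseteq> (\<Union>j\<in>I. ball (x j) (r j))}.
        \<Sum>\<^sub>\<infinity>j\<in>I. ennreal (h (r j)))"

definition hausdorff_measure :: "(real \<Rightarrow> real) \<Rightarrow> real set \<Rightarrow> ennreal" where
  "hausdorff_measure h E = Lim (at_right 0) (hausdorff_content h E)"

section \<open>Logarithmic capacity\<close>

definition log_kernel :: "real \<Rightarrow> complex \<Rightarrow> complex \<Rightarrow> ennreal" where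
  "log_kernel s z w =
     (if z = w then \<infinity> else ennreal (log_gauge 1 (norm (z - w)) powr (- s)))"

definition prob_measures_on :: "complex set \<Rightarrow> complex measure set" where
  "prob_measures_on K = {\<mu>. sets \<mu> = sets borel \<and> prob_space \<mu> \<and> emeasure \<mu> (- K) = 0}"

definition log_energy :: "real \<Rightarrow> complex measure \<Rightarrow> ennreal" where
  "log_energy s \<mu> = (\<integral>\<^sup>+ w. (\<integral>\<^sup>+ z. log_kernel s z w \<partial>\<mu>) \<partial>\<mu>)"

text \<open>In \<^typ>\<open>ennreal\<close>, the infimum over the empty family (\<open>K = {}\<close>) is \<open>\<infinity>\<close>
  and \<open>inverse \<infinity> = 0\<close>.\<close>
definition log_cap_compact :: "real \<Rightarrow> complex set \<Rightarrow> ennreal" where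
  "log_cap_compact s K = inverse (INF \<mu> \<in> prob_measures_on K. log_energy s \<mu>)"

definition log_cap :: "real \<Rightarrow> complex set \<Rightarrow> ennreal" where
  "log_cap s E = (SUP K \<in> {K. compact K \<and> K \<subseteq> E}. log_cap_compact s K)"

definition cap_dim :: "complex set \<Rightarrow> ennreal" where
  "cap_dim E = (SUP s \<in> {s. 0 < s \<and> 0 < log_cap s E}. ennreal s)"

end

theory Submission
  imports Defs "HOL-Real_Asymp.Real_Asymp"
begin

text \<open>
  Membership in the Brjuno set is a matter of rational approximation, because the convergents of an
  irrational \<open>x\<close> satisfy \<open>\<bar>x - P\<^sub>n / Q\<^sub>n\<bar> < 1 / (Q\<^sub>n Q\<^sub>n\<^sub>+\<^sub>1)\<close>. Two one-sided statements suffice. A number that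
  for every \<open>n\<close> lies within \<open>exp (- n q)\<close> of some fraction \<open>p / q\<close> is not a Brjuno number
  (\<open>super_exponential_approximation_imp_non_brjuno\<close>). Conversely, for each \<open>\<sigma> < 1\<close>, a number that is not
  Brjuno lies within \<open>exp (- q\<^sup>\<sigma>)\<close> of fractions \<open>p / q\<close> with arbitrarily large \<open>q\<close>
  (\<open>non_brjuno_imp_subexponential_approximation\<close>), since \<open>Q\<^sub>n\<close> grows exponentially and makes
  \<open>\<Sum> Q\<^sub>n powr (\<sigma> - 1)\<close> converge.

  Upper bounds. A unit interval contains about \<open>q\<close> fractions with denominator \<open>q\<close>, and an interval of
  radius \<open>exp (- q\<^sup>\<sigma>)\<close> has gauge \<open>q powr (- \<sigma> \<delta>)\<close>. For \<open>\<delta> > 2\<close> one can choose \<open>\<sigma>\<close> with \<open>\<sigma> \<delta> > 2\<close>, and then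
  \<open>\<Sum> q powr (1 - \<sigma> \<delta>)\<close> converges; this gives Hausdorff measure zero
  (\<open>hausdorff_measure_non_brjuno_eq_0\<close>). A set that carries a measure of finite \<open>s\<close>-energy has infinite
  Hausdorff measure for the gauge of exponent \<open>s\<close> (\<open>hausdorff_measure_infinite_of_finite_energy\<close>). For
  \<open>s > 2\<close> this forces the capacity to vanish, and for \<open>\<delta> \<le> 2\<close> it turns finite energy of exponent 2 into
  infinite Hausdorff measure. All other claims therefore follow from one object: a probability
  measure of finite energy of exponent 2 on a compact set of non-Brjuno numbers inside the interval.

  Construction of the measure. Start from a uniform distribution and, for \<open>n = 0, 1, 2, \<dots>\<close>, move the
  mass into the \<open>exp (- n q)\<close>-neighbourhoods of the fractions \<open>p / q\<close>
  (\<open>exists_measure_near_rationals\<close>). Suppose that the current measure has density at most \<open>D\<close>, and send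
  each point \<open>x\<close> to a fraction \<open>p / q\<close> with \<open>q \<le> Q\<close> and \<open>\<bar>x - p / q\<bar> < 1 / (q Q)\<close>, as provided by Dirichlet. The
  fraction \<open>p / q\<close> collects mass of order \<open>D / (q Q)\<close> in an interval whose logarithmic length is of order
  \<open>n q\<close>, and the energy that these intervals have in themselves adds up to a constant that does not tend
  to zero as \<open>Q\<close> grows. Exponent 2 is the largest one for which it stays bounded. It is made
  small by choosing the scale at random among \<open>Q, 2 Q, 4 Q, \<dots>\<close> (\<open>M\<close> of them): now \<open>p / q\<close> collects mass at
  most \<open>4 D / (M q\<^sup>2)\<close>, because the contributions of the scales above \<open>q\<close> form a geometric series, and the
  self-energy is of order \<open>n\<^sup>2 D / M\<close>. The interaction between different fractions costs hardly more than
  the energy before the step: points move by at most \<open>2 / Q\<close>, so only pairs at distance below \<open>1 / \<surd>Q\<close>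
  are affected noticeably, these have mass of order \<open>D / \<surd>Q\<close>, and different fractions are so well separated
  that the kernel between them is only a power of \<open>log Q\<close>
  (\<open>energy_of_discretised_measure\<close>). Hence each step keeps the energy below a bound fixed in advance.
  The supports shrink to a compact set of non-Brjuno numbers, and a weak limit of the measures lives on
  it; its energy stays bounded by Fatou's lemma, applied after Skorohod's theorem has turned weak
  convergence into pointwise convergence (\<open>exists_finite_energy_measure_on_non_brjuno\<close>).
\<close>

section \<open>Continued fraction convergents and Brjuno numbers\<close>

text \<open>The recursion runs from the left, the direction in which \<^const>\<open>finite_cf\<close> is evaluated, so that
  statements about \<open>x\<close> follow by induction from those about the tail \<open>1 / frac x\<close>.\<close>
fun cf_num :: "real \<Rightarrow> nat \<Rightarrow> int" and cf_den :: "real \<Rightarrow> nat \<Rightarrow> int" where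
  "cf_num x 0 = \<lfloor>x\<rfloor>"
| "cf_num x (Suc n) = \<lfloor>x\<rfloor> * cf_num (1 / frac x) n + cf_den (1 / frac x) n"
| "cf_den x 0 = 1"
| "cf_den x (Suc n) = cf_num (1 / frac x) n"

lemma irrational_inverse_frac:
  assumes "x \<notin> \<rat>"
  shows "1 / frac x \<notin> \<rat>" "1 < 1 / frac x"
proof -
  have "frac x \<notin> \<rat>"
    using assms Rats_add[OF _ Rats_of_int, of "frac x" "\<lfloor>x\<rfloor>"] by (auto simp: frac_def)
  then show "1 / frac x \<notin> \<rat>"
    using Rats_divide[OF Rats_1, of "1 / frac x"] by auto
  have "frac x \<noteq> 0" using \<open>frac x \<notin> \<rat>\<close> by (metis Rats_0)
  then have "0 < frac x" using frac_ge_0[of x] by linarith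
  then show "1 < 1 / frac x" using frac_lt_1[of x] by simp
qed

lemma cf_complete_quotient_shift:
  "cf_complete_quotient x (Suc n) = cf_complete_quotient (1 / frac x) n"
  by (induction n) auto

lemma cf_partial_quotient_shift:
  "cf_partial_quotient x (Suc n) = cf_partial_quotient (1 / frac x) n"
  unfolding cf_partial_quotient_def cf_complete_quotient_shift ..

lemma cf_partial_quotient_ge_1:
  assumes "x \<notin> \<rat>"
  shows "1 \<le> cf_partial_quotient x (Suc n)"
  using assms
proof (induction n arbitrary: x)
  case 0
  then show ?case using irrational_inverse_frac(2)[OF 0] by (simp add: cf_partial_quotient_def)
next
  case (Suc n)
  then show ?case using irrational_inverse_frac(1) cf_partial_quotient_shift by metis
qed

lemma cf_den_num_pos:
  assumes "x \<notin> \<rat>"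
  shows "0 < cf_den x n" "1 < x \<Longrightarrow> 0 < cf_num x n"
  using assms
proof (induction n arbitrary: x)
  case 0
  { case 1 show ?case by simp }
  { case 2 then show ?case by simp }
next
  case (Suc n)
  note * = irrational_inverse_frac
  { case 1 then show ?case using Suc.IH(2)[OF *(2,1)] by simp }
  { case 2
    then have "0 < cf_num (1 / frac x) n" "0 < cf_den (1 / frac x) n" "0 < \<lfloor>x\<rfloor>"
      using Suc.IH(2)[OF *(2,1)] Suc.IH(1)[OF *(1)] by auto
    then show ?case by (simp add: add_pos_pos) }
qed

lemma cf_num_den_recurrence:
  "cf_num x (Suc (Suc n)) = cf_partial_quotient x (Suc (Suc n)) * cf_num x (Suc n) + cf_num x n"
  "cf_den x (Suc (Suc n)) = cf_partial_quotient x (Suc (Suc n)) * cf_den x (Suc n) + cf_den x n"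
proof (induction n arbitrary: x)
  case 0
  { case 1 show ?case by (simp add: cf_partial_quotient_def algebra_simps) }
  { case 2 show ?case by (simp add: cf_partial_quotient_def algebra_simps) }
next
  case (Suc n)
  { case 1 show ?case
      using Suc.IH[of "1 / frac x"]
      by (simp add: cf_partial_quotient_shift[of x] algebra_simps
          del: cf_num.simps(2) cf_den.simps(2) add: cf_num.simps(2)[of x] cf_den.simps(2)[of x]) }
  { case 2 show ?case
      using Suc.IH(1)[of "1 / frac x"]
      by (simp add: cf_partial_quotient_shift[of x] algebra_simps
          del: cf_num.simps(2) cf_den.simps(2) add: cf_num.simps(2)[of x] cf_den.simps(2)[of x]) }
qed

lemma cf_determinant:
  "cf_num x (Suc n) * cf_den x n - cf_num x n * cf_den x (Suc n) = (-1) ^ n"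
proof (induction n arbitrary: x)
  case 0 show ?case by simp
next
  case (Suc n)
  show ?case using Suc.IH[of "1 / frac x"] 
    by (simp add: algebra_simps del: cf_num.simps(2) cf_den.simps(2) add: cf_num.simps(2)[of x] cf_den.simps(2)[of x])
qed

text \<open>The convergents lie alternately below and above \<open>x\<close>: passing from the tail \<open>y\<close> to \<open>\<lfloor>x\<rfloor> + 1 / y\<close> reverses
  the order.\<close>
lemma cf_alternating:
  assumes "x \<notin> \<rat>"
  shows "0 < (-1) ^ n * (real_of_int (cf_den x n) * x - real_of_int (cf_num x n))"
  using assms
proof (induction n arbitrary: x)
  case 0
  then have "real_of_int \<lfloor>x\<rfloor> \<noteq> x" by (metis Rats_of_int)
  then show ?case by (simp add: less_le)
next
  case (Suc n)
  let ?y = "1 / frac x"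
  let ?P = "real_of_int (cf_num ?y n)" let ?Q = "real_of_int (cf_den ?y n)"
  have y: "?y \<notin> \<rat>" "1 < ?y" using irrational_inverse_frac Suc.prems by auto
  then have pos: "0 < frac x" by (metis less_trans zero_less_divide_1_iff zero_less_one)
  have "(- 1) ^ Suc n * (real_of_int (cf_den x (Suc n)) * x - real_of_int (cf_num x (Suc n)))
      = (- 1) ^ n * (?Q - ?P * frac x)"
    by (simp add: frac_def algebra_simps)
  also have "\<dots> = frac x * ((- 1) ^ n * (?Q * ?y - ?P))"
    using pos by (simp add: field_simps)
  also have "\<dots> > 0" using pos Suc.IH[OF y(1)] by (rule mult_pos_pos)
  finally show ?case .
qed

lemma cf_convergent_eq_num_div_den:
  assumes "x \<notin> \<rat>"
  shows "cf_convergent x n = of_int (cf_num x n) / of_int (cf_den x n)"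
  using assms
proof (induction n arbitrary: x)
  case 0 show ?case by (simp add: cf_convergent_def cf_partial_quotient_def)
next
  case (Suc n)
  let ?y = "1 / frac x"
  have y: "?y \<notin> \<rat>" "1 < ?y" using irrational_inverse_frac Suc.prems by auto
  have "map (cf_partial_quotient x) [0..<Suc (Suc n)]
      = \<lfloor>x\<rfloor> # map (cf_partial_quotient ?y) [0..<Suc n]"
    by (subst upt_conv_Cons, simp, subst map_Suc_upt[symmetric])
       (simp add: cf_partial_quotient_shift o_def, simp add: cf_partial_quotient_def)
  moreover have "finite_cf (a # map f [0..<Suc n]) = of_int a + 1 / finite_cf (map f [0..<Suc n])"
    for a f by (subst upt_conv_Cons, simp, subst upt_conv_Cons, simp) simp
  ultimately have "cf_convergent x (Suc n) = of_int \<lfloor>x\<rfloor> + 1 / cf_convergent ?y n"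
    by (simp add: cf_convergent_def del: upt_Suc)
  also have "\<dots> = of_int (cf_num x (Suc n)) / of_int (cf_den x (Suc n))"
    unfolding Suc.IH[OF y(1)] using cf_den_num_pos[OF y(1), of n] y(2) by (simp add: field_simps)
  finally show ?case .
qed

text \<open>A common divisor divides the determinant, which is \<open>\<plusminus>1\<close>; the fractions \<open>P\<^sub>n / Q\<^sub>n\<close> are therefore reduced.\<close>
lemma coprime_cf_num_den: "coprime (cf_num x n) (cf_den x n)"
proof (rule coprimeI)
  fix d assume "d dvd cf_num x n" "d dvd cf_den x n"
  then have "d dvd (-1) ^ n"
    unfolding cf_determinant[of x n, symmetric] by (intro dvd_diff) auto
  then show "is_unit d"
    by (metis dvd_refl is_unit_power_iff dvd_trans unit_imp_dvd dvd_minus_iff)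
qed

lemma cf_denom_eq_cf_den:
  assumes "x \<notin> \<rat>"
  shows "cf_denom x n = cf_den x n"
proof -
  note coprime_cf_num_den[of x n]
  moreover have "0 < cf_den x n" using cf_den_num_pos assms by auto
  ultimately have "quotient_of (Fract (cf_num x n) (cf_den x n)) = (cf_num x n, cf_den x n)"
    by (simp add: quotient_of_Fract Rat.normalize_def)
  then show ?thesis
    by (simp add: cf_denom_def cf_convergent_eq_num_div_den[OF assms] Fract_of_int_quotient)
qed

lemma cf_den_super_additive:
  assumes "x \<notin> \<rat>"
  shows "cf_den x (Suc n) + cf_den x n \<le> cf_den x (Suc (Suc n))"
  using cf_partial_quotient_ge_1[OF assms, of "Suc n"] cf_den_num_pos(1)[OF assms, of "Suc n"]
  unfolding cf_num_den_recurrence by (simp del: cf_den.simps)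

lemma cf_den_Suc_le:
  assumes "x \<notin> \<rat>"
  shows "cf_den x n \<le> cf_den x (Suc n)"
proof (cases n)
  case 0
  then show ?thesis using cf_den_num_pos(1)[OF assms, of 1] by simp
next
  case (Suc m)
  then show ?thesis
    using cf_den_super_additive[OF assms, of m] cf_den_num_pos(1)[OF assms, of m]
    by (simp del: cf_den.simps)
qed

text \<open>The denominators at least double every two steps. Splitting by parity avoids irrational growth rates.\<close>
lemma cf_den_exponential_growth:
  assumes "x \<notin> \<rat>"
  shows "2 ^ n \<le> cf_den x (2 * n)" "2 ^ n \<le> cf_den x (Suc (2 * n))"
proof (induction n)
  case 0
  { case 1 show ?case by simp }
  { case 2 show ?case using cf_den_num_pos(1)[OF assms, of 1] by simp }
next
  case (Suc n)
  have *: "cf_den x m + cf_den x m \<le> cf_den x (Suc (Suc m))" for m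
    using cf_den_super_additive[OF assms, of m] cf_den_Suc_le[OF assms, of m] by linarith
  { case 1 show ?case using *[of "2 * n"] Suc.IH by (simp del: cf_den.simps) }
  { case 2 show ?case using *[of "Suc (2 * n)"] Suc.IH by (simp del: cf_den.simps) }
qed

text \<open>\<open>x\<close> lies strictly between two consecutive convergents, and by the determinant identity these are
  \<open>1 / (Q\<^sub>n Q\<^sub>n\<^sub>+\<^sub>1)\<close> apart.\<close>
lemma cf_approximation:
  assumes "x \<notin> \<rat>"
  shows "\<bar>x - cf_num x n / cf_den x n\<bar> < 1 / (cf_den x n * cf_den x (Suc n))"
proof -
  let ?P = "\<lambda>n. real_of_int (cf_num x n)" let ?Q = "\<lambda>n. real_of_int (cf_den x n)"
  have Q: "0 < ?Q m" for m using cf_den_num_pos(1)[OF assms] by simp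
  define s :: real where "s = (-1) ^ n"
  have s: "s * s = 1" "\<bar>s\<bar> = 1" by (auto simp: s_def simp flip: power_mult_distrib)
  have 1: "0 < s * (?Q n * x - ?P n)" using cf_alternating[OF assms, of n] by (simp add: s_def)
  have 2: "s * (?Q (Suc n) * x - ?P (Suc n)) < 0" using cf_alternating[OF assms, of "Suc n"] by (simp add: s_def)
  have 3: "?P (Suc n) * ?Q n - ?P n * ?Q (Suc n) = s"
    unfolding s_def using cf_determinant[of x n] by (metis of_int_diff of_int_minus of_int_1 of_int_mult of_int_power)
  have "?Q (Suc n) * (s * (?Q n * x - ?P n)) < 1"
  proof -
    have "?Q (Suc n) * (s * (?Q n * x - ?P n)) = ?Q n * (s * (?Q (Suc n) * x - ?P (Suc n)))
        + s * (?P (Suc n) * ?Q n - ?P n * ?Q (Suc n))" by (simp add: algebra_simps)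
    also have "\<dots> < 1" unfolding 3 s using 2 Q[of n] by (simp add: mult_pos_neg)
    finally show ?thesis .
  qed
  moreover have "\<bar>x - ?P n / ?Q n\<bar> = s * (?Q n * x - ?P n) / ?Q n"
  proof -
    have "x - ?P n / ?Q n = (?Q n * x - ?P n) / ?Q n" using Q[of n] by (simp add: field_simps)
    moreover have "\<bar>?Q n * x - ?P n\<bar> = s * (?Q n * x - ?P n)"
      using 1 s by (metis abs_mult abs_of_pos mult_1)
    ultimately show ?thesis using Q[of n] by simp
  qed
  ultimately have "\<bar>x - ?P n / ?Q n\<bar> < 1 / ?Q (Suc n) / ?Q n"
    using Q[of n] Q[of "Suc n"] by (simp add: divide_strict_right_mono pos_less_divide_eq mult.commute)
  then show ?thesis by (simp add: mult.commute)
qed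

text \<open>For a Brjuno number the terms of the series are bounded, say \<open>ln Q\<^sub>k\<^sub>+\<^sub>1 \<le> B Q\<^sub>k\<close>. A fraction \<open>p / q\<close> with
  \<open>Q\<^sub>k \<le> q < Q\<^sub>k\<^sub>+\<^sub>1\<close> differs from the reduced fraction \<open>P\<^sub>k\<^sub>+\<^sub>1 / Q\<^sub>k\<^sub>+\<^sub>1\<close>, and comparison with it shows
  \<open>\<bar>x - p / q\<bar> \<ge> 1 / (q Q\<^sub>k\<^sub>+\<^sub>1\<^sup>2)\<close>. This exceeds \<open>exp (- n q)\<close> as soon as \<open>n \<ge> 2 B + 2\<close>.\<close>
lemma super_exponential_approximation_imp_non_brjuno:
  fixes x :: real
  assumes "\<And>n::nat. \<exists>(p::int) (q::int). (0::int) < q \<and> \<bar>x - p / q\<bar> < exp (- (real n * q))"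
  shows "x \<in> non_brjuno"
proof (rule ccontr)
  assume "x \<notin> non_brjuno"
  then have irr: "x \<notin> \<rat>"
    and sum: "summable (\<lambda>n. ln (cf_denom x (Suc n)) / cf_denom x n)"
    by (auto simp: non_brjuno_def brjuno_def)
  let ?Q = "cf_den x"
  have Q: "0 < ?Q m" for m using cf_den_num_pos(1)[OF irr] .
  from sum have "Bseq (\<lambda>n. ln (?Q (Suc n)) / ?Q n)"
    unfolding cf_denom_eq_cf_den[OF irr] by (blast intro: convergent_imp_Bseq summable_LIMSEQ_zero convergentI)
  then obtain B where B: "\<And>n. \<bar>ln (?Q (Suc n)) / ?Q n\<bar> \<le> B"
    unfolding Bseq_def by (auto simp del: cf_den.simps)
  obtain n :: nat where n: "2 * B + 2 \<le> n" using real_arch_simple by blast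
  obtain p q :: int where q: "0 < q" and pq: "\<bar>x - p / q\<bar> < exp (- (real n * q))"
    using assms[of n] by auto
  have "\<exists>j. q < ?Q j"
  proof
    have "q < 2 ^ nat q" using q of_nat_less_two_power[of "nat q", where 'a=int] by simp
    also have "\<dots> \<le> ?Q (2 * nat q)" by (rule cf_den_exponential_growth(1)[OF irr])
    finally show "q < ?Q (2 * nat q)" .
  qed
  define j where "j = (LEAST j. q < ?Q j)"
  have j: "q < ?Q j" unfolding j_def using \<open>\<exists>j. q < ?Q j\<close> by (rule LeastI_ex)
  have "j \<noteq> 0" using j q by (intro notI) simp
  then obtain k where k: "j = Suc k" by (cases j) auto
  have Qk: "?Q k \<le> q" using not_less_Least[of k "\<lambda>j. q < ?Q j"] k unfolding j_def by simp
  define R S where "R = real_of_int (?Q j)" and "S = real_of_int (?Q (Suc j))"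
  have R: "real_of_int q + 1 \<le> R" using j unfolding R_def by linarith
  have S: "R \<le> S" using cf_den_Suc_le[OF irr, of j] unfolding R_def S_def by simp
  let ?P = "real_of_int (cf_num x j)"
  have q1: "1 \<le> real_of_int q" using q by linarith
  have "p * ?Q j \<noteq> cf_num x j * q"
  proof
    assume eq: "p * ?Q j = cf_num x j * q"
    have "coprime (?Q j) (cf_num x j)"
      using coprime_cf_num_den by (simp add: coprime_commute)
    then have "?Q j dvd q" using eq by (metis coprime_dvd_mult_right_iff dvd_triv_right)
    then show False using zdvd_imp_le[of "?Q j" q] j q by linarith
  qed
  then have "1 \<le> \<bar>p * ?Q j - cf_num x j * q\<bar>" by linarith
  then have "1 \<le> \<bar>p * R - ?P * q\<bar>" unfolding R_def by (simp flip: of_int_mult of_int_diff of_int_abs)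
  then have "1 / (q * R) \<le> \<bar>p / q - ?P / R\<bar>"
    using q1 R by (simp add: divide_simps abs_mult flip: abs_divide) (simp add: field_simps)
  also have "\<dots> \<le> \<bar>x - p / q\<bar> + \<bar>x - ?P / R\<bar>" by linarith
  also have "\<dots> \<le> exp (- (real n * q)) + 1 / (R * S)"
    using pq cf_approximation[OF irr, of j] unfolding R_def S_def by simp
  also have "1 / (R * S) \<le> 1 / (R * R)" using R S q1 by (intro divide_left_mono mult_left_mono) auto
  finally have "1 / (q * R) - 1 / (R * R) \<le> exp (- (real n * q))" by simp
  \<comment> \<open>the gap uses \<open>q + 1 \<le> R\<close>: both are integers and \<open>q < R\<close>\<close>
  moreover have "1 / (q * R * R) \<le> 1 / (q * R) - 1 / (R * R)"
    using q1 R by (simp add: field_simps)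
  ultimately have "1 / (q * R * R) \<le> exp (- (real n * q))" by simp
  then have "ln (1 / (q * R * R)) \<le> - (real n * q)"
    using q1 R by (subst (asm) ln_le_cancel_iff[symmetric]) auto
  then have "n * q \<le> ln q + 2 * ln R"
    using q1 R by (simp add: ln_div ln_mult)
  moreover have "ln q \<le> real_of_int q - 1" using q1 by (intro ln_le_minus_one) auto
  ultimately have "(real n - 1) * real_of_int q < 2 * ln R" by (simp add: algebra_simps)
  moreover have "ln R \<le> B * ?Q k"
    using B[of k] Q[of k] unfolding R_def k by (simp add: abs_le_iff divide_le_eq del: cf_den.simps)
  moreover have "0 \<le> B" using B[of 0] by linarith
  moreover have "B * ?Q k \<le> B * q" using Qk \<open>0 \<le> B\<close> by (intro mult_left_mono) auto
  ultimately have "(real n - 1 - 2 * B) * real_of_int q < 0" by (simp add: algebra_simps)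
  then show False using n q1 by (simp add: mult_less_0_iff)
qed

text \<open>If \<open>ln Q\<^sub>n\<^sub>+\<^sub>1 < Q\<^sub>n powr \<sigma>\<close> held for all large \<open>n\<close>, the Brjuno series would be dominated by
  \<open>\<Sum> Q\<^sub>n powr (\<sigma> - 1)\<close>, which decays geometrically. A rational \<open>x\<close> equals fractions with arbitrarily large,
  not necessarily reduced, denominators.\<close>
lemma non_brjuno_imp_subexponential_approximation:
  fixes x \<sigma> :: real and N :: int
  assumes x: "x \<in> non_brjuno" and \<sigma>: "0 < \<sigma>" "\<sigma> < 1"
  shows "\<exists>p q. N \<le> q \<and> 0 < q \<and> \<bar>x - real_of_int p / q\<bar> < exp (- (q powr \<sigma>))"
proof (cases "x \<in> \<rat>")
  case True
  then obtain a b :: int where ab: "0 < b" "x = a / b"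
    by (metis Rats_cases' )
  define m where "m = max 1 N"
  have "N \<le> b * m" "0 < b * m"
    using ab(1) mult_right_mono[of 1 b m] by (auto simp: m_def)
  moreover have "\<bar>x - real_of_int (a * m) / real_of_int (b * m)\<bar> = 0"
    using ab by (simp add: m_def)
  ultimately show ?thesis by (metis exp_gt_zero)
next
  case False
  let ?Q = "\<lambda>n. real_of_int (cf_den x n)"
  have Q: "1 \<le> ?Q m" for m using cf_den_num_pos(1)[OF False, of m] by linarith
  have not_sum: "\<not> summable (\<lambda>n. ln (?Q (Suc n)) / ?Q n)"
    using x False by (auto simp: non_brjuno_def brjuno_def cf_denom_eq_cf_den simp del: cf_den.simps)
  define r where "r = 2 powr ((\<sigma> - 1) / 2)"
  have r: "0 < r" "r < 1" using \<sigma> unfolding r_def by (auto simp: powr_less_one)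
  have growth: "2 powr ((real n - 1) / 2) \<le> ?Q n" for n
  proof -
    obtain d where d: "d = n div 2" by simp
    then have "n \<le> 2 * d + 1" by presburger
    then have "real n \<le> real (2 * d + 1)" by (simp only: of_nat_le_iff)
    then have "(real n - 1) / 2 \<le> real (n div 2)" unfolding d[symmetric] by simp
    then have "2 powr ((real n - 1) / 2) \<le> 2 powr (real (n div 2))" by (intro powr_mono) auto
    also have "\<dots> = real_of_int (2 ^ (n div 2))" by (simp add: powr_realpow)
    also have "\<dots> \<le> ?Q n"
      unfolding of_int_le_iff using cf_den_exponential_growth[OF False, of "n div 2"]
      by (cases "even n") (auto elim!: evenE oddE simp del: cf_den.simps)
    finally show ?thesis .
  qed
  have decay: "?Q n powr (\<sigma> - 1) \<le> 2 powr ((1 - \<sigma>) / 2) * r ^ n" for n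
  proof -
    have "?Q n powr (\<sigma> - 1) \<le> (2 powr ((real n - 1) / 2)) powr (\<sigma> - 1)"
      using \<sigma> growth by (intro powr_mono2') auto
    also have "\<dots> = 2 powr ((1 - \<sigma>) / 2) * (r powr n)"
    proof -
      have "(real n - 1) / 2 * (\<sigma> - 1) = (1 - \<sigma>) / 2 + (\<sigma> - 1) / 2 * n"
        by (simp add: field_simps)
      then show ?thesis by (simp only: r_def powr_powr powr_add)
    qed
    finally show ?thesis using r by (simp add: powr_realpow)
  qed
  have "\<exists>n. N \<le> cf_den x n \<and> ?Q n powr \<sigma> \<le> ln (?Q (Suc n))"
  proof (rule ccontr)
    assume *: "\<not> ?thesis"
    have "summable (\<lambda>n. 2 powr ((1 - \<sigma>) / 2) * r ^ n)"
      using r by (intro summable_mult summable_geometric) auto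
    moreover have "eventually (\<lambda>n. norm (ln (?Q (Suc n)) / ?Q n) \<le> 2 powr ((1 - \<sigma>) / 2) * r ^ n) sequentially"
    proof (rule eventually_sequentiallyI[of "2 * nat N"])
      fix n assume n: "2 * nat N \<le> n"
      have "N \<le> cf_den x n"
      proof -
        have "N \<le> int (nat N)" by simp
        also have "\<dots> \<le> int (n div 2)" using n by linarith
        also have "\<dots> \<le> 2 ^ (n div 2)" using of_nat_less_two_power[of "n div 2", where 'a=int] by linarith
        also have "\<dots> \<le> cf_den x n"
          using cf_den_exponential_growth[OF False, of "n div 2"]
          by (cases "even n") (auto elim!: evenE oddE simp del: cf_den.simps)
        finally show ?thesis .
      qed
      with * have "ln (?Q (Suc n)) \<le> ?Q n powr \<sigma>" by force
      then have "ln (?Q (Suc n)) / ?Q n \<le> ?Q n powr \<sigma> / ?Q n"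
        using Q[of n] by (intro divide_right_mono) auto
      also have "\<dots> = ?Q n powr (\<sigma> - 1)" using Q[of n] by (simp add: powr_diff)
      also note decay[of n]
      finally show "norm (ln (?Q (Suc n)) / ?Q n) \<le> 2 powr ((1 - \<sigma>) / 2) * r ^ n"
        using Q[of n] Q[of "Suc n"] by (simp del: cf_den.simps)
    qed
    ultimately have "summable (\<lambda>n. ln (?Q (Suc n)) / ?Q n)"
      by (rule summable_comparison_test_ev[rotated])
    then show False using not_sum by contradiction
  qed
  then obtain n where n: "N \<le> cf_den x n" "?Q n powr \<sigma> \<le> ln (?Q (Suc n))" by blast
  have "\<bar>x - cf_num x n / ?Q n\<bar> < 1 / (?Q n * ?Q (Suc n))" 
    using cf_approximation[OF False, of n] by simp
  also have "\<dots> \<le> 1 / ?Q (Suc n)"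
    using Q[of n] Q[of "Suc n"] by (intro divide_left_mono) (auto simp del: cf_den.simps)
  also have "\<dots> = exp (- ln (?Q (Suc n)))"
    using Q[of "Suc n"] by (simp add: exp_minus inverse_eq_divide del: cf_den.simps)
  also have "\<dots> \<le> exp (- (?Q n powr \<sigma>))" using n(2) by simp
  finally show ?thesis using n(1) cf_den_num_pos(1)[OF False, of n] by blast
qed

section \<open>Kernels, gauges and the capacity bound for Hausdorff measures\<close>

text \<open>The kernel as a function of the distance only, so that the same function serves the plane and the
  real line.\<close>
definition radial_kernel :: "real \<Rightarrow> real \<Rightarrow> ennreal" where
  "radial_kernel s r = (if r = 0 then \<infinity> else ennreal (max 1 (- ln r) powr s))"

lemma log_gauge_eq_max: "0 < r \<Longrightarrow> log_gauge \<delta> r = max 1 (- ln r) powr (- \<delta>)"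
proof -
  assume r: "0 < r"
  have "r < 1 / exp 1 \<longleftrightarrow> ln r < ln (1 / exp 1)" using r by (subst ln_less_cancel_iff) auto
  also have "\<dots> \<longleftrightarrow> ln r < - 1" by (simp add: ln_div)
  finally show ?thesis using r by (simp add: log_gauge_def ln_div max_def)
qed

lemma log_kernel_eq_radial: "log_kernel s z w = radial_kernel s (norm (z - w))"
proof (cases "z = w")
  case False
  then have "log_gauge 1 (norm (z - w)) powr (- s) = max 1 (- ln (norm (z - w))) powr s"
    by (subst log_gauge_eq_max) (simp_all only: powr_powr, auto)
  then show ?thesis using False by (simp add: log_kernel_def radial_kernel_def)
qed (simp add: log_kernel_def radial_kernel_def)

lemma measurable_radial_kernel [measurable]: "radial_kernel s \<in> borel_measurable borel"
  unfolding radial_kernel_def by measurable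

lemma radial_kernel_antimono:
  assumes "0 \<le> r" "r \<le> r'" "0 \<le> s"
  shows "radial_kernel s r' \<le> radial_kernel s r"
proof (cases "r = 0")
  case False
  then have "- ln r' \<le> - ln r" using assms by simp
  then have "max 1 (- ln r') \<le> max 1 (- ln r)" by linarith
  then show ?thesis using False assms by (auto simp: radial_kernel_def intro!: ennreal_leI powr_mono2)
qed (simp add: radial_kernel_def)

lemma radial_kernel_mono_exponent: "s \<le> s' \<Longrightarrow> radial_kernel s r \<le> radial_kernel s' r"
  by (auto simp: radial_kernel_def intro!: ennreal_leI powr_mono)

lemma infsum_ennreal_leI:
  fixes f :: "'a \<Rightarrow> ennreal"
  assumes "\<And>F. finite F \<Longrightarrow> F \<subseteq> A \<Longrightarrow> sum f F \<le> B"
  shows "infsum f A \<le> B"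
  by (subst nonneg_infsum_complete) (auto intro!: SUP_least assms)

lemma sum_le_infsum_ennreal:
  fixes f :: "'a \<Rightarrow> ennreal"
  assumes "finite F" "F \<subseteq> A"
  shows "sum f F \<le> infsum f A"
  using assms by (subst nonneg_infsum_complete) (auto intro!: SUP_upper)

lemma infsum_cmult_left_ennreal:
  fixes f :: "'a \<Rightarrow> ennreal"
  shows "(\<Sum>\<^sub>\<infinity>x\<in>A. c * f x) = c * infsum f A"
  by (subst (1 2) nonneg_infsum_complete) (auto simp: SUP_mult_left_ennreal sum_distrib_left)

lemma emeasure_UN_le_infsum:
  fixes I :: "nat set"
  assumes "\<And>j. j \<in> I \<Longrightarrow> A j \<in> sets M" "\<And>j. j \<in> I \<Longrightarrow> emeasure M (A j) \<le> f j"
  shows "emeasure M (\<Union>j\<in>I. A j) \<le> infsum f I"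
proof -
  let ?A = "\<lambda>j. if j \<in> I then A j else {}"
  have "(\<Union>j\<in>I. A j) = (\<Union>j. ?A j)" by (auto split: if_splits)
  also have "emeasure M \<dots> \<le> (\<Sum>j. emeasure M (?A j))"
    by (rule emeasure_subadditive_countably) (use assms in auto)
  also have "\<dots> \<le> infsum f I"
    unfolding suminf_eq_SUP
  proof (rule SUP_least)
    fix n
    have "(\<Sum>j<n. emeasure M (?A j)) = (\<Sum>j\<in>{..<n} \<inter> I. emeasure M (A j))"
      by (subst sum.inter_restrict) (auto intro!: sum.cong)
    also have "\<dots> \<le> (\<Sum>j\<in>{..<n} \<inter> I. f j)" by (intro sum_mono assms) auto
    also have "\<dots> \<le> infsum f I" by (rule sum_le_infsum_ennreal) auto
    finally show "(\<Sum>j<n. emeasure M (?A j)) \<le> infsum f I" .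
  qed
  finally show ?thesis .
qed

text \<open>A finite potential at \<open>w\<close> rules out an atom there, since the kernel is infinite on the diagonal. The
  integrands thus tend to 0 almost everywhere and are dominated by the kernel.\<close>
lemma tendsto_local_potential:
  fixes \<mu> :: "complex measure"
  assumes [measurable_cong]: "sets \<mu> = sets borel"
    and fin: "(\<integral>\<^sup>+ z. radial_kernel s (norm (z - w)) \<partial>\<mu>) < \<infinity>"
  shows "(\<lambda>n. \<integral>\<^sup>+ z. radial_kernel s (norm (z - w)) * indicator (ball w (inverse (Suc n))) z \<partial>\<mu>) \<longlonglongrightarrow> 0"
proof -
  have "AE z in \<mu>. radial_kernel s (norm (z - w)) \<noteq> \<infinity>"
    by (rule nn_integral_noteq_infinite) (use fin in auto)
  then have ne: "AE z in \<mu>. z \<noteq> w"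
    by eventually_elim (auto simp: radial_kernel_def)
  have "(\<lambda>n. \<integral>\<^sup>+ z. radial_kernel s (norm (z - w)) * indicator (ball w (inverse (Suc n))) z \<partial>\<mu>)
      \<longlonglongrightarrow> (\<integral>\<^sup>+ z. 0 \<partial>\<mu>)"
  proof (rule nn_integral_dominated_convergence[where w = "\<lambda>z. radial_kernel s (norm (z - w))"])
    show "AE z in \<mu>. (\<lambda>n. radial_kernel s (norm (z - w)) * indicator (ball w (inverse (Suc n))) z) \<longlonglongrightarrow> 0"
      using ne
    proof eventually_elim
      case (elim z)
      then have "0 < dist w z" by simp
      then obtain N where "inverse (real (Suc N)) < dist w z" using reals_Archimedean by blast
      then have "\<And>n. n \<ge> N \<Longrightarrow> radial_kernel s (norm (z - w)) * indicator (ball w (inverse (Suc n))) z = 0"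
        by (auto simp: indicator_def) (smt (verit) inverse_less_iff_less of_nat_0_less_iff of_nat_mono zero_less_Suc of_nat_Suc)
      then show ?case
        by (intro tendsto_eventually) (auto simp: eventually_sequentially)
    qed
  qed (use fin in \<open>auto simp: indicator_def\<close>)
  then show ?thesis by simp
qed

text \<open>For almost every \<open>w\<close> the part of the potential that comes from a small disc about \<open>w\<close> is below any given
  \<open>c\<close>. On a set of measure above \<open>1/2\<close> this holds for one common radius, and there the discs of radius
  \<open>t\<close> about \<open>w\<close> have measure at most \<open>c\<close> times the gauge of \<open>t\<close>. Every cover by small balls then has gauge sum
  at least a constant times \<open>1 / c\<close>, and \<open>c\<close> is arbitrary. That the local part is
  small, and not merely bounded, is what makes the measure infinite instead of just positive.\<close>
theorem hausdorff_measure_infinite_of_finite_energy: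
  fixes \<mu> :: "complex measure" and E :: "real set"
  assumes sets [measurable_cong]: "sets \<mu> = sets borel" and "prob_space \<mu>"
    and K: "K \<in> sets borel" "emeasure \<mu> (- K) = 0" "K \<subseteq> complex_of_real ` E"
    and fin: "log_energy s \<mu> < \<infinity>" and s: "0 < s"
  shows "hausdorff_measure (log_gauge s) E = \<infinity>"
proof -
  interpret prob_space \<mu> by fact
  have sp: "space \<mu> = UNIV" using sets_eq_imp_space_eq[OF sets] by simp
  let ?k = "\<lambda>z w. radial_kernel s (norm (z - w))"
  have "AE w in \<mu>. (\<integral>\<^sup>+ z. ?k z w \<partial>\<mu>) \<noteq> \<infinity>"
    using fin unfolding log_energy_def log_kernel_eq_radial
    by (intro nn_integral_noteq_infinite) auto
  then have finae: "AE w in \<mu>. (\<integral>\<^sup>+ z. ?k z w \<partial>\<mu>) < \<infinity>" by (simp add: top.not_eq_extremum)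
  have key: "\<forall>\<^sub>F \<epsilon> in at_right 0. ennreal (1 / (2 * (c * 2 powr s))) \<le> hausdorff_content (log_gauge s) E \<epsilon>"
    if c: "0 < c" for c
  proof -
    define A where "A n = {w. (\<integral>\<^sup>+ z. ?k z w * indicator (ball w (inverse (Suc n))) z \<partial>\<mu>) \<le> ennreal c}" for n
    have [measurable]: "{(w,z). z \<in> ball w r} \<in> sets (borel \<Otimes>\<^sub>M (borel :: complex measure))" for r
    proof -
      have "Measurable.pred (borel \<Otimes>\<^sub>M (borel :: complex measure)) (\<lambda>p. dist (fst p) (snd p) < r)"
        by measurable
      then show ?thesis by (simp add: pred_def space_pair_measure case_prod_unfold)
    qed
    have Ain: "A n \<in> sets \<mu>" for n
    proof -
      have "(\<lambda>(w, z). ?k z w * indicator {(w,z). z \<in> ball w (inverse (Suc n))} (w, z)) \<in> borel_measurable (borel \<Otimes>\<^sub>M \<mu>)"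
        by measurable
      then have "(\<lambda>w. \<integral>\<^sup>+ z. ?k z w * indicator {(w,z). z \<in> ball w (inverse (Suc n))} (w, z) \<partial>\<mu>) \<in> borel_measurable borel"
        by (intro borel_measurable_nn_integral) simp
      also have "(\<lambda>w. \<integral>\<^sup>+ z. ?k z w * indicator {(w,z). z \<in> ball w (inverse (Suc n))} (w, z) \<partial>\<mu>)
        = (\<lambda>w. \<integral>\<^sup>+ z. ?k z w * indicator (ball w (inverse (Suc n))) z \<partial>\<mu>)"
        by (auto simp: indicator_def)
      finally show ?thesis unfolding A_def by measurable
    qed
    have "incseq A"
      unfolding incseq_def A_def
    proof (safe, rule order_trans[rotated], assumption)
      fix m n :: nat and w :: complex assume "m \<le> n"
      then have "inverse (real (Suc n)) \<le> inverse (real (Suc m))" by simp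
      then have "ball w (inverse (real (Suc n))) \<subseteq> ball w (inverse (real (Suc m)))" by (rule subset_ball)
      then show "(\<integral>\<^sup>+ z. ?k z w * indicator (ball w (inverse (Suc n))) z \<partial>\<mu>)
          \<le> (\<integral>\<^sup>+ z. ?k z w * indicator (ball w (inverse (Suc m))) z \<partial>\<mu>)"
        by (intro nn_integral_mono mult_left_mono) (auto simp: indicator_def)
    qed
    have "AE w in \<mu>. w \<in> (\<Union>n. A n)"
      using finae
    proof eventually_elim
      case (elim w)
      from tendsto_local_potential[OF sets elim]
      have "\<forall>\<^sub>F n in sequentially. (\<integral>\<^sup>+ z. ?k z w * indicator (ball w (inverse (Suc n))) z \<partial>\<mu>) < ennreal c"
        by (rule order_tendstoD) (use c in simp)
      then show ?case unfolding A_def by (auto dest!: eventually_happens' [OF sequentially_bot] less_imp_le)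
    qed
    then have "emeasure \<mu> (\<Union>n. A n) = 1" using Ain by (intro emeasure_eq_1_AE) auto
    then have "(\<lambda>n. emeasure \<mu> (A n)) \<longlonglongrightarrow> 1"
      using Lim_emeasure_incseq[of A \<mu>] Ain \<open>incseq A\<close> by auto
    then have "\<forall>\<^sub>F n in sequentially. ennreal (1/2) < emeasure \<mu> (A n)"
      by (rule order_tendstoD) (simp add: ennreal_less_one_iff del: ennreal_half)
    then obtain n where n: "ennreal (1/2) < emeasure \<mu> (A n)"
      by (auto dest!: eventually_happens' [OF sequentially_bot])
    \<comment> \<open>a ball of the cover that meets \<open>A n\<close> lies in a disc of twice its radius about a point of \<open>A n\<close>;
      the first bound keeps that disc inside the one used in \<open>A n\<close>, the second ensures \<open>ln (1 / t) \<ge> ln (1 / r) / 2\<close> for \<open>t = 2 r\<close> and keeps \<open>t\<close> below \<open>1 / e\<close>\<close>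
    define \<rho> where "\<rho> = min (inverse (Suc n)) (exp (-1) / 2) / 2"
    have \<rho>: "0 < \<rho>" "2 * \<rho> \<le> inverse (Suc n)" "\<rho> \<le> exp (-1) / 4" by (auto simp: \<rho>_def)
    have "ennreal (1 / (2 * (c * 2 powr s))) \<le> hausdorff_content (log_gauge s) E \<epsilon>"
      if \<epsilon>: "0 < \<epsilon>" "\<epsilon> < \<rho>" for \<epsilon>
      unfolding hausdorff_content_def
    proof (rule INF_greatest, clarify)
      fix I :: "nat set" and x r :: "nat \<Rightarrow> real"
      assume r: "\<forall>j\<in>I. 0 < r j \<and> r j < \<epsilon>" and cov: "E \<subseteq> (\<Union>j\<in>I. ball (x j) (r j))"
      let ?B = "\<lambda>j. ball (complex_of_real (x j)) (r j)"
      have ball: "emeasure \<mu> (?B j \<inter> A n) \<le> ennreal (c * 2 powr s) * ennreal (log_gauge s (r j))" if j: "j \<in> I" for j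
      proof (cases "?B j \<inter> A n = {}")
        case False
        then obtain w where w: "dist (complex_of_real (x j)) w < r j" "w \<in> A n" by auto
        define t where "t = 2 * r j"
        have t: "0 < t" "t < inverse (Suc n)" "t \<le> exp (-1) / 2"
          using r j \<epsilon> \<rho> unfolding t_def by force+
        have sub: "?B j \<subseteq> ball w t"
        proof
          fix z assume "z \<in> ?B j"
          then show "z \<in> ball w t" using w(1) dist_triangle[of w z "complex_of_real (x j)"]
            by (simp add: t_def dist_commute)
        qed
        have "radial_kernel s t * emeasure \<mu> (?B j) = (\<integral>\<^sup>+ z. radial_kernel s t * indicator (?B j) z \<partial>\<mu>)"
          by (simp add: nn_integral_cmult_indicator)
        also have "\<dots> \<le> (\<integral>\<^sup>+ z. ?k z w * indicator (ball w (inverse (Suc n))) z \<partial>\<mu>)"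
        proof (intro nn_integral_mono)
          fix z
          show "radial_kernel s t * indicator (?B j) z \<le> ?k z w * indicator (ball w (inverse (Suc n))) z"
          proof (cases "z \<in> ?B j")
            case True
            then have "dist w z < t" using sub by auto
            then have "norm (z - w) \<le> t" "z \<in> ball w (inverse (Suc n))" using t
              by (auto simp: dist_norm norm_minus_commute)
            then show ?thesis using s by (auto simp: indicator_def intro!: radial_kernel_antimono)
          qed auto
        qed
        also have "\<dots> \<le> ennreal c" using w(2) by (simp add: A_def)
        finally have le: "radial_kernel s t * emeasure \<mu> (?B j) \<le> ennreal c" .
        have lnt: "- ln (r j) / 2 \<le> - ln t" "1 \<le> - ln t" "0 < - ln (r j)" "1 \<le> - ln (r j)"
        proof -
          have "ln t \<le> ln (exp (-1) / 2)" using t by (subst ln_le_cancel_iff) auto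
          also have "\<dots> = - 1 - ln 2" by (simp add: ln_div)
          finally have a: "ln t \<le> - 1 - ln 2" .
          have b: "ln t = ln 2 + ln (r j)" using t(1) unfolding t_def by (subst ln_mult) auto
          have c: "0 < ln (2::real)" "ln (2::real) \<le> 1" using ln_2_less_1 by auto
          show "- ln (r j) / 2 \<le> - ln t" "1 \<le> - ln t" "0 < - ln (r j)" "1 \<le> - ln (r j)" using a b c by linarith+
        qed
        have rj: "0 < r j" using r j by auto
        have "emeasure \<mu> (?B j \<inter> A n) \<le> emeasure \<mu> (?B j)" by (rule emeasure_mono) auto
        also have "\<dots> = ennreal (measure \<mu> (?B j))" by (simp add: emeasure_eq_measure)
        also have "\<dots> \<le> ennreal (c * (- ln t) powr (- s))"
        proof (rule ennreal_leI)
          have "radial_kernel s t = ennreal ((- ln t) powr s)"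
            using t(1) lnt by (simp add: radial_kernel_def max_def)
          then have "(- ln t) powr s * measure \<mu> (?B j) \<le> c"
            using le c by (simp add: emeasure_eq_measure flip: ennreal_mult')
          then show "measure \<mu> (?B j) \<le> c * (- ln t) powr (- s)"
            using lnt by (simp add: powr_minus field_simps)
        qed
        also have "\<dots> \<le> ennreal (c * (- ln (r j) / 2) powr (- s))"
          using s c lnt by (intro ennreal_leI mult_left_mono powr_mono2') auto
        also have "(- ln (r j) / 2) powr (- s) = 2 powr s * log_gauge s (r j)"
        proof -
          have "(- ln (r j) / 2) powr (- s) = (- ln (r j)) powr (- s) / 2 powr (- s)"
            by (rule powr_divide)
          also have "\<dots> = 2 powr s * (- ln (r j)) powr (- s)" by (simp add: powr_minus_divide)
          also have "(- ln (r j)) powr (- s) = log_gauge s (r j)"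
            using lnt by (simp add: log_gauge_eq_max[OF rj] max_def)
          finally show ?thesis .
        qed
        finally show ?thesis using c by (simp add: ennreal_mult' mult.assoc)
      qed auto
      have "A n \<inter> K \<subseteq> (\<Union>j\<in>I. ?B j \<inter> A n)"
      proof
        fix w assume w: "w \<in> A n \<inter> K"
        then obtain y where "y \<in> E" "w = complex_of_real y" using K(3) by auto
        moreover from this obtain j where "j \<in> I" "dist (x j) y < r j" using cov by auto
        moreover have "dist (complex_of_real (x j)) (complex_of_real y) = dist (x j) y"
          by (simp add: dist_norm flip: of_real_diff)
        ultimately show "w \<in> (\<Union>j\<in>I. ?B j \<inter> A n)" using w by auto
      qed
      have "ennreal (1/2) \<le> emeasure \<mu> (A n)" using n by simp
      also have "\<dots> \<le> emeasure \<mu> (A n \<inter> K) + emeasure \<mu> (- K)"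
        using K(1) Ain[of n] by (intro order_trans[OF emeasure_mono emeasure_subadditive]) (auto simp: sets)
      also have "\<dots> = emeasure \<mu> (A n \<inter> K)" using K(2) by simp
      also have "\<dots> \<le> emeasure \<mu> (\<Union>j\<in>I. ?B j \<inter> A n)"
        using \<open>A n \<inter> K \<subseteq> _\<close> Ain by (intro emeasure_mono) auto
      also have "\<dots> \<le> (\<Sum>\<^sub>\<infinity>j\<in>I. ennreal (c * 2 powr s) * ennreal (log_gauge s (r j)))"
        using Ain ball by (intro emeasure_UN_le_infsum) auto
      also have "\<dots> = ennreal (c * 2 powr s) * (\<Sum>\<^sub>\<infinity>j\<in>I. ennreal (log_gauge s (r j)))"
        by (rule infsum_cmult_left_ennreal)
      finally have fin: "ennreal (1/2) \<le> ennreal (c * 2 powr s) * (\<Sum>\<^sub>\<infinity>j\<in>I. ennreal (log_gauge s (r j)))" .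
      have "ennreal (1 / (2 * (c * 2 powr s))) = ennreal (1/2) / ennreal (c * 2 powr s)"
        using c by (subst divide_ennreal) auto
      also have "\<dots> \<le> (\<Sum>\<^sub>\<infinity>j\<in>I. ennreal (log_gauge s (r j)))"
        using fin c by (intro divide_le_posI_ennreal) (auto simp: mult.commute)
      finally show "ennreal (1 / (2 * (c * 2 powr s))) \<le> (\<Sum>\<^sub>\<infinity>j\<in>I. ennreal (log_gauge s (r j)))" .
    qed
    then show ?thesis using \<rho>(1) by (auto simp: eventually_at_right_field)
  qed
  have "(hausdorff_content (log_gauge s) E \<longlongrightarrow> \<infinity>) (at_right 0)"
    unfolding infinity_ennreal_def tendsto_top_iff_ennreal
  proof (intro allI impI)
    fix l :: real assume "0 \<le> l"
    define c where "c = 1 / (2 * (l + 1) * 2 powr s)"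
    have "0 < c" "1 / (2 * (c * 2 powr s)) = l + 1" using \<open>0 \<le> l\<close> by (auto simp: c_def)
    from key[OF this(1)] show "\<forall>\<^sub>F \<epsilon> in at_right 0. ennreal l < hausdorff_content (log_gauge s) E \<epsilon>"
      unfolding \<open>_ = l + 1\<close>
      by eventually_elim (use \<open>0 \<le> l\<close> in \<open>auto intro: less_le_trans[rotated] simp: ennreal_less_iff\<close>)
  qed
  then show ?thesis
    unfolding hausdorff_measure_def by (intro tendsto_Lim trivial_limit_at_right_real)
qed

section \<open>Covering the non-Brjuno numbers\<close>

text \<open>The intervals of radius \<open>exp (- q powr \<sigma>)\<close> about all \<open>p / q\<close> with \<open>q \<ge> N\<close> and \<open>\<bar>p\<bar> \<le> q powr (1 + \<theta>)\<close> cover the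
  whole set at once: a point has to be reached only for large \<open>q\<close>, and \<open>\<bar>p / q\<bar> \<le> q powr \<theta>\<close> then holds
  automatically. Allowing \<open>q powr \<theta>\<close> in place of a fixed bound avoids a decomposition of the line and costs
  only the factor \<open>q powr \<theta>\<close> in the number of fractions.\<close>
theorem hausdorff_measure_non_brjuno_eq_0:
  assumes "2 < \<delta>"
  shows "hausdorff_measure (log_gauge \<delta>) non_brjuno = 0"
proof -
  \<comment> \<open>chosen so that the number of fractions times the gauge of one interval is of order
      \<open>q powr (1 + \<theta> - \<sigma> \<delta>) = q powr (- 1 - \<theta>)\<close>\<close>
  define \<theta> \<sigma> where "\<theta> = (\<delta> - 2) / 4" and "\<sigma> = (2 + 2 * \<theta>) / \<delta>"
  have \<theta>: "0 < \<theta>" "\<delta> = 2 + 4 * \<theta>" using assms by (auto simp: \<theta>_def field_simps)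
  have \<sigma>: "0 < \<sigma>" "\<sigma> < 1" "\<sigma> * \<delta> = 2 + 2 * \<theta>"
    using assms \<theta> by (auto simp: \<sigma>_def)
  define P where "P q = {p::int. \<bar>real_of_int p\<bar> \<le> real q powr (1 + \<theta>)}" for q :: nat
  have card_P: "finite (P q)" "real (card (P q)) \<le> 3 * real q powr (1 + \<theta>)" if "1 \<le> q" for q
  proof -
    define k where "k = \<lfloor>real q powr (1 + \<theta>)\<rfloor>"
    have q1: "1 \<le> real q powr (1 + \<theta>)" using that \<theta> by (intro ge_one_powr_ge_zero) auto
    then have k: "1 \<le> k" by (simp add: k_def le_floor_iff)
    have sub: "P q \<subseteq> {- k..k}"
    proof
      fix p assume "p \<in> P q"
      then have "real_of_int p \<le> real q powr (1 + \<theta>)" "real_of_int (- p) \<le> real q powr (1 + \<theta>)"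
        unfolding P_def by auto
      then have "p \<le> k" "- p \<le> k" unfolding k_def by (simp_all only: le_floor_iff)
      then show "p \<in> {- k..k}" by auto
    qed
    then show "finite (P q)" by (rule finite_subset) simp
    have "card (P q) \<le> card {- k..k}" using sub by (intro card_mono) auto
    then have "real (card (P q)) \<le> 2 * real_of_int k + 1" using k by simp
    also have "real_of_int k \<le> real q powr (1 + \<theta>)" unfolding k_def by (rule of_int_floor_le)
    finally show "real (card (P q)) \<le> 3 * real q powr (1 + \<theta>)" using q1 by simp
  qed
  define \<rho> where "\<rho> q = exp (- (real q powr \<sigma>))" for q :: nat
  have gauge: "log_gauge \<delta> (\<rho> q) = real q powr (- 2 - 2 * \<theta>)" if "1 \<le> q" for q
  proof -
    have "1 \<le> real q powr \<sigma>" using that \<sigma> by (intro ge_one_powr_ge_zero) auto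
    then have "log_gauge \<delta> (\<rho> q) = (real q powr \<sigma>) powr (- \<delta>)"
      by (simp add: log_gauge_eq_max \<rho>_def max_def)
    also have "\<dots> = real q powr (- (\<sigma> * \<delta>))" by (simp add: powr_powr)
    finally show ?thesis unfolding \<sigma>(3) by simp
  qed
  have "hausdorff_content (log_gauge \<delta>) non_brjuno \<epsilon> \<le> ennreal \<eta>" if \<epsilon>: "0 < \<epsilon>" and \<eta>: "0 < \<eta>" for \<epsilon> \<eta>
  proof -
    have "summable (\<lambda>q. 3 * real q powr (- 1 - \<theta>))"
      using \<theta> by (intro summable_mult) (simp add: summable_real_powr_iff)
    from summable_partial_sum_bound[OF this \<eta>] obtain N1
      where N1: "\<And>m n. N1 \<le> m \<Longrightarrow> norm (\<Sum>q=m..n. 3 * real q powr (- 1 - \<theta>)) < \<eta>" by blast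
    have "\<rho> \<longlonglongrightarrow> 0" unfolding \<rho>_def using \<sigma>(1) by real_asymp
    then have "\<forall>\<^sub>F q in sequentially. \<rho> q < \<epsilon>" using \<epsilon> by (rule order_tendstoD)
    then obtain N2 where N2: "\<And>q. N2 \<le> q \<Longrightarrow> \<rho> q < \<epsilon>" by (auto simp: eventually_sequentially)
    define N where "N = Max {1, N1, N2}"
    have N: "1 \<le> N" "N1 \<le> N" "N2 \<le> N" by (auto simp: N_def)
    define T where "T = (SIGMA q:{N..}. P q)"
    define I where "I = to_nat ` T"
    let ?x = "\<lambda>j. case from_nat j of (q::nat, p::int) \<Rightarrow> real_of_int p / real q"
    let ?r = "\<lambda>j. case from_nat j of (q::nat, p::int) \<Rightarrow> \<rho> q"
    have "hausdorff_content (log_gauge \<delta>) non_brjuno \<epsilon> \<le> (\<Sum>\<^sub>\<infinity>j\<in>I. ennreal (log_gauge \<delta> (?r j)))"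
      unfolding hausdorff_content_def
    proof (rule INF_lower2[where i = "(I, ?x, ?r)"])
      have "non_brjuno \<subseteq> (\<Union>j\<in>I. ball (?x j) (?r j))"
      proof
        fix x assume x: "x \<in> non_brjuno"
        have "filterlim (\<lambda>q::nat. real q powr \<theta>) at_top sequentially" using \<theta>(1) by real_asymp
        then have "\<forall>\<^sub>F q in sequentially. \<bar>x\<bar> + 1 \<le> real q powr \<theta>"
          unfolding filterlim_at_top by blast
        then obtain N3 where N3: "\<And>q. N3 \<le> q \<Longrightarrow> \<bar>x\<bar> + 1 \<le> real q powr \<theta>"
          by (auto simp: eventually_sequentially)
        obtain p q :: int where pq: "int (max N N3) \<le> q" "0 < q"
            "\<bar>x - real_of_int p / q\<bar> < exp (- (q powr \<sigma>))"
          using non_brjuno_imp_subexponential_approximation[OF x \<sigma>(1,2), of "int (max N N3)"] by auto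
        define n where "n = nat q"
        have n: "N \<le> n" "N3 \<le> n" "1 \<le> n" "real_of_int q = real n" using pq(1,2) by (auto simp: n_def)
        have close: "\<bar>x - p / real n\<bar> < \<rho> n" using pq(3) unfolding \<rho>_def n(4) .
        have "\<rho> n \<le> 1" by (simp add: \<rho>_def)
        then have "\<bar>p / real n\<bar> \<le> \<bar>x\<bar> + 1" using close by linarith
        also have "\<dots> \<le> real n powr \<theta>" using N3 n by auto
        finally have "\<bar>real_of_int p\<bar> \<le> real n powr \<theta> * real n" using n(3) by (simp add: abs_divide divide_le_eq)
        also have "\<dots> = real n powr (1 + \<theta>)" using n(3) by (simp add: powr_add)
        finally have "(n, p) \<in> T" using n(1) by (auto simp: T_def P_def)
        then have "to_nat (n, p) \<in> I" by (simp add: I_def)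
        moreover have "x \<in> ball (?x (to_nat (n, p))) (?r (to_nat (n, p)))"
          using close by (simp add: dist_real_def abs_minus_commute)
        ultimately show "x \<in> (\<Union>j\<in>I. ball (?x j) (?r j))" by blast
      qed
      moreover have "\<forall>j\<in>I. 0 < ?r j \<and> ?r j < \<epsilon>"
        using N N2 by (auto simp: I_def T_def \<rho>_def)
      ultimately show "(I, ?x, ?r) \<in> {(I, x, r). (\<forall>j\<in>I. 0 < r j \<and> r j < \<epsilon>) \<and> non_brjuno \<subseteq> (\<Union>j\<in>I. ball (x j) (r j))}"
        by blast
    qed simp
    also have "\<dots> = (\<Sum>\<^sub>\<infinity>(q,p)\<in>T. ennreal (log_gauge \<delta> (\<rho> q)))"
      unfolding I_def by (subst infsum_reindex) (auto simp: o_def case_prod_unfold intro: inj_on_subset[OF inj_to_nat])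
    also have "\<dots> \<le> ennreal \<eta>"
    proof (rule infsum_ennreal_leI)
      fix F assume F: "finite F" "F \<subseteq> T"
      define G where "G = {N..Max (insert N (fst ` F))}"
      have FG: "F \<subseteq> (SIGMA q:G. P q)"
        using F by (auto simp: G_def T_def intro!: Max_ge rev_image_eqI)
      have G: "1 \<le> q" if "q \<in> G" for q using that N(1) by (auto simp: G_def)
      have "(\<Sum>(q,p)\<in>F. ennreal (log_gauge \<delta> (\<rho> q))) \<le> (\<Sum>(q,p)\<in>(SIGMA q:G. P q). ennreal (log_gauge \<delta> (\<rho> q)))"
        using FG card_P(1) G by (intro sum_mono2) (auto simp: G_def)
      also have "\<dots> = (\<Sum>q\<in>G. \<Sum>p\<in>P q. ennreal (log_gauge \<delta> (\<rho> q)))"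
        using card_P(1) G by (subst sum.Sigma) (auto simp: G_def)
      also have "\<dots> = (\<Sum>q\<in>G. ennreal (real (card (P q)) * real q powr (- 2 - 2 * \<theta>)))"
        using G by (intro sum.cong) (auto simp: gauge ennreal_mult' ennreal_of_nat_eq_real_of_nat)
      also have "\<dots> \<le> (\<Sum>q\<in>G. ennreal (3 * real q powr (- 1 - \<theta>)))"
      proof (intro sum_mono ennreal_leI)
        fix q assume "q \<in> G"
        then have "real (card (P q)) * real q powr (- 2 - 2 * \<theta>) \<le> 3 * real q powr (1 + \<theta>) * real q powr (- 2 - 2 * \<theta>)"
          using card_P(2) G by (intro mult_right_mono) auto
        also have "\<dots> = 3 * real q powr (- 1 - \<theta>)"
          by (simp add: powr_add[symmetric] mult.assoc)
        finally show "real (card (P q)) * real q powr (- 2 - 2 * \<theta>) \<le> 3 * real q powr (- 1 - \<theta>)" .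
      qed
      also have "\<dots> = ennreal (\<Sum>q\<in>G. 3 * real q powr (- 1 - \<theta>))" by (intro sum_ennreal) auto
      also have "\<dots> \<le> ennreal \<eta>"
        using abs_le_D1[OF less_imp_le[OF N1[OF N(2), unfolded real_norm_def]]]
        unfolding G_def by (rule ennreal_leI)
      finally show "(\<Sum>(q,p)\<in>F. ennreal (log_gauge \<delta> (\<rho> q))) \<le> ennreal \<eta>" .
    qed
    finally show ?thesis .
  qed
  note * = this
  have zero: "hausdorff_content (log_gauge \<delta>) non_brjuno \<epsilon> = 0" if "0 < \<epsilon>" for \<epsilon>
  proof (rule antisym)
    show "hausdorff_content (log_gauge \<delta>) non_brjuno \<epsilon> \<le> 0"
      by (rule ennreal_le_epsilon) (use * that in auto)
  qed simp
  have "(hausdorff_content (log_gauge \<delta>) non_brjuno \<longlongrightarrow> 0) (at_right 0)"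
    by (rule tendsto_eventually) (auto simp: eventually_at_right_field zero intro: exI[of _ 1])
  then show ?thesis
    unfolding hausdorff_measure_def by (intro tendsto_Lim trivial_limit_at_right_real)
qed

section \<open>The logarithmic energy of measures with bounded density\<close>

definition sq_energy :: "real measure \<Rightarrow> ennreal" where
  "sq_energy \<mu> = (\<integral>\<^sup>+ x. (\<integral>\<^sup>+ y. radial_kernel 2 \<bar>x - y\<bar> \<partial>\<mu>) \<partial>\<mu>)"

definition density_bounded_by :: "real \<Rightarrow> real measure \<Rightarrow> bool" where
  "density_bounded_by D \<mu> \<longleftrightarrow> sets \<mu> = sets borel \<and> 0 \<le> D \<and>
     (\<forall>S\<in>sets borel. emeasure \<mu> S \<le> ennreal D * emeasure lborel S)"

lemma emeasure_density_bounded_le: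
  assumes "density_bounded_by D \<mu>" "S \<in> sets borel"
  shows "emeasure \<mu> S \<le> ennreal D * emeasure lborel S"
  using assms by (simp add: density_bounded_by_def)

lemma radial_kernel_two: "0 < r \<Longrightarrow> radial_kernel 2 r = ennreal ((max 1 (- ln r))\<^sup>2)"
  by (simp add: radial_kernel_def powr_numeral)

lemma nn_integral_density_bounded_le:
  assumes "density_bounded_by D \<mu>" and [measurable]: "f \<in> borel_measurable borel"
  shows "(\<integral>\<^sup>+ x. f x \<partial>\<mu>) \<le> ennreal D * (\<integral>\<^sup>+ x. f x \<partial>lborel)"
proof -
  have "(\<integral>\<^sup>+ x. f x \<partial>\<mu>) \<le> (\<integral>\<^sup>+ x. f x \<partial>scale_measure (ennreal D) lborel)"
    using assms(1) unfolding density_bounded_by_def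
    by (intro nn_integral_mono_measure) (auto simp: le_measure)
  also have "\<dots> = ennreal D * (\<integral>\<^sup>+ x. f x \<partial>lborel)" by (intro nn_integral_scale_measure) simp
  finally show ?thesis .
qed

text \<open>The logarithm grows more slowly than any power; the exponent \<open>1/4\<close> leaves an integrable square.\<close>
lemma radial_kernel_le_inverse_sqrt:
  assumes "0 < t" "t \<le> 1"
  shows "radial_kernel 2 t \<le> ennreal (16 * t powr (- (1/2)))"
proof -
  let ?w = "t powr (- (1/4))"
  have "0 < ?w" using assms by simp
  have "1 \<le> ?w" using powr_mono2'[of "- (1/4)" t 1] assms by simp
  have "- ln t = 4 * ln ?w" using assms by (simp add: ln_powr)
  also have "\<dots> \<le> 4 * ?w" using ln_le_minus_one[OF \<open>0 < ?w\<close>] by linarith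
  finally have "max 1 (- ln t) \<le> 4 * ?w" using \<open>1 \<le> ?w\<close> by simp
  then have "(max 1 (- ln t))\<^sup>2 \<le> (4 * ?w)\<^sup>2" by (intro power_mono) auto
  also have "\<dots> = 16 * t powr (- (1/2))"
    using assms by (simp add: power_mult_distrib power2_eq_square powr_add[symmetric])
  finally show ?thesis using assms by (simp add: radial_kernel_two ennreal_leI)
qed

lemma nn_integral_radial_kernel_near_0:
  "(\<integral>\<^sup>+ t. radial_kernel 2 \<bar>t\<bar> * indicator {-1..1} t \<partial>lborel) \<le> 64"
proof -
  define g where "g t = ennreal (indicat_real {0..1} t * (16 * t powr (- (1/2))))" for t :: real
  have [measurable]: "g \<in> borel_measurable borel" unfolding g_def by measurable
  have "((\<lambda>t. 16 * t powr (- (1/2))) has_integral (16 * (1 powr (- (1/2) + 1) / (- (1/2) + 1)))) {0..1::real}"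
    by (intro has_integral_mult_right has_integral_powr_from_0) auto
  then have g: "(\<integral>\<^sup>+ t. g t \<partial>lborel) = 32"
    unfolding g_def by (subst nn_integral_has_integral_lebesgue) auto
  then have g': "(\<integral>\<^sup>+ t. g (- t) \<partial>lborel) = 32"
    using nn_integral_real_affine[of g "-1" 0] by simp
  have "AE t in lborel. t \<noteq> (0::real)" by (rule AE_lborel_singleton)
  then have "(\<integral>\<^sup>+ t. radial_kernel 2 \<bar>t\<bar> * indicator {-1..1} t \<partial>lborel) \<le> (\<integral>\<^sup>+ t. g t + g (- t) \<partial>lborel)"
  proof (intro nn_integral_mono_AE, eventually_elim)
    case (elim t)
    show ?case
    proof (cases "t \<in> {-1..1}")
      case True
      then have "radial_kernel 2 \<bar>t\<bar> \<le> ennreal (16 * \<bar>t\<bar> powr (- (1/2)))"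
        using elim by (intro radial_kernel_le_inverse_sqrt) auto
      also have "\<dots> \<le> g t + g (- t)"
        using True elim by (cases "0 < t") (auto simp: g_def)
      finally show ?thesis using True by simp
    qed simp
  qed
  also have "\<dots> = 64" using g g' by (subst nn_integral_add) auto
  finally show ?thesis .
qed

lemma potential_le_of_density_bounded:
  assumes D: "density_bounded_by D \<mu>" and "prob_space \<mu>"
  shows "(\<integral>\<^sup>+ y. radial_kernel 2 \<bar>x - y\<bar> \<partial>\<mu>) \<le> ennreal (64 * D + 1)"
proof -
  interpret prob_space \<mu> by fact
  have [measurable_cong]: "sets \<mu> = sets borel" and D0: "0 \<le> D" using D by (auto simp: density_bounded_by_def)
  let ?f = "\<lambda>t. radial_kernel 2 \<bar>t\<bar> * indicator {-1..1} t"
  have "(\<integral>\<^sup>+ y. radial_kernel 2 \<bar>x - y\<bar> \<partial>\<mu>) \<le> (\<integral>\<^sup>+ y. ?f (x - y) + 1 \<partial>\<mu>)"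
  proof (intro nn_integral_mono)
    fix y
    have "radial_kernel 2 \<bar>x - y\<bar> \<le> 1" if "1 < \<bar>x - y\<bar>"
    proof -
      have "max 1 (- ln \<bar>x - y\<bar>) = 1" using ln_gt_zero[OF that] by linarith
      then show ?thesis using that by (simp add: radial_kernel_two)
    qed
    then show "radial_kernel 2 \<bar>x - y\<bar> \<le> ?f (x - y) + 1"
      by (cases "x - y \<in> {-1..1}") (auto simp: abs_le_iff not_le)
  qed
  also have "\<dots> = (\<integral>\<^sup>+ y. ?f (x - y) \<partial>\<mu>) + 1"
    by (subst nn_integral_add) (auto simp: emeasure_space_1)
  also have "(\<integral>\<^sup>+ y. ?f (x - y) \<partial>\<mu>) \<le> ennreal D * (\<integral>\<^sup>+ y. ?f (x - y) \<partial>lborel)"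
    by (intro nn_integral_density_bounded_le[OF D]) measurable
  also have "(\<integral>\<^sup>+ y. ?f (x - y) \<partial>lborel) = (\<integral>\<^sup>+ t. ?f t \<partial>lborel)"
    using nn_integral_real_affine[of ?f "-1" x] by simp
  also have "\<dots> \<le> 64" by (rule nn_integral_radial_kernel_near_0)
  also have "ennreal D * 64 + 1 = ennreal (64 * D + 1)"
    using D0 by (simp add: ennreal_mult' mult.commute)
  finally show ?thesis by (simp add: add_mono mult_left_mono)
qed

text \<open>Controls the energy of a copy of a measure shrunk by the factor \<open>c\<close>: shrinking adds \<open>- ln c\<close> to the
  logarithm, and \<open>(a + b)\<^sup>2 \<le> 2 a\<^sup>2 + 2 b\<^sup>2\<close>.\<close>
lemma radial_kernel_two_scale:
  assumes "0 < c" "c \<le> 1" "0 \<le> r"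
  shows "radial_kernel 2 (c * r) \<le> 2 * radial_kernel 2 r + ennreal (2 * (ln c)\<^sup>2)"
proof (cases "r = 0")
  case False
  then have r: "0 < r" using assms by simp
  have "ln c \<le> 0" using assms by simp
  moreover have "ln (c * r) = ln c + ln r" using assms r by (simp add: ln_mult)
  ultimately have "max 1 (- ln (c * r)) \<le> max 1 (- ln r) + (- ln c)" by linarith
  then have "(max 1 (- ln (c * r)))\<^sup>2 \<le> (max 1 (- ln r) + (- ln c))\<^sup>2" by (intro power_mono) auto
  also have "\<dots> \<le> 2 * (max 1 (- ln r))\<^sup>2 + 2 * (ln c)\<^sup>2"
  proof -
    have "(a + b)\<^sup>2 \<le> 2 * a\<^sup>2 + 2 * b\<^sup>2" for a b :: real
      using sum_squares_bound[of a b] by (simp add: power2_sum)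
    from this[of "max 1 (- ln r)" "- ln c"] show ?thesis by simp
  qed
  finally have "radial_kernel 2 (c * r) \<le> ennreal (2 * (max 1 (- ln r))\<^sup>2 + 2 * (ln c)\<^sup>2)"
    using assms r by (simp add: radial_kernel_two ennreal_leI del: ennreal_plus)
  also have "\<dots> = 2 * radial_kernel 2 r + ennreal (2 * (ln c)\<^sup>2)"
    using r by (simp add: radial_kernel_two ennreal_mult')
  finally show ?thesis .
qed (simp add: radial_kernel_def ennreal_mult_top)

text \<open>Changing distances by a factor close to 1 changes the kernel by a factor close to 1, because the
  logarithm is cut off below at 1 and so absorbs the additive error \<open>\<beta>\<close>.\<close>
lemma radial_kernel_two_contract:
  assumes "0 < \<beta>" "0 < r" "exp (- \<beta>) * r \<le> r'"
  shows "radial_kernel 2 r' \<le> ennreal ((1 + \<beta>)\<^sup>2) * radial_kernel 2 r"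
proof -
  have "0 < exp (- \<beta>) * r" using assms by simp
  then have "0 < r'" using assms(3) by linarith
  have "ln (exp (- \<beta>) * r) \<le> ln r'" using assms(3) \<open>0 < exp (- \<beta>) * r\<close> \<open>0 < r'\<close> by simp
  then have "- ln r' \<le> - ln r + \<beta>" using assms by (simp add: ln_mult)
  also have "\<dots> \<le> max 1 (- ln r) + \<beta> * max 1 (- ln r)"
    using mult_left_mono[of 1 "max 1 (- ln r)" \<beta>] assms(1) by (intro add_mono) auto
  finally have "max 1 (- ln r') \<le> (1 + \<beta>) * max 1 (- ln r)"
    using mult_mono[of 1 "1 + \<beta>" 1 "max 1 (- ln r)"] assms(1) by (simp add: algebra_simps)
  then have "(max 1 (- ln r'))\<^sup>2 \<le> ((1 + \<beta>) * max 1 (- ln r))\<^sup>2" by (intro power_mono) auto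
  then show ?thesis
    using \<open>0 < r'\<close> assms by (simp add: radial_kernel_two ennreal_leI power_mult_distrib flip: ennreal_mult'')
qed

definition unif01 :: "real measure" where "unif01 = uniform_measure lborel {0..1}"

lemma sets_unif01 [measurable_cong, simp]: "sets unif01 = sets borel"
  by (simp add: unif01_def)

lemma space_unif01 [simp]: "space unif01 = UNIV"
  by (simp add: unif01_def)

lemma prob_space_unif01: "prob_space unif01"
  unfolding unif01_def by (rule prob_space_uniform_measure) auto

lemma density_bounded_unif01: "density_bounded_by 1 unif01"
  unfolding density_bounded_by_def unif01_def
  by (auto intro!: emeasure_mono simp: divide_ennreal_def)

lemma AE_unif01: "AE u in unif01. 0 \<le> u \<and> u \<le> 1"
  unfolding unif01_def by (rule AE_uniform_measureI) auto

text \<open>The point \<open>X \<omega>\<close> is replaced by a uniformly distributed point of the interval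
  \<open>[c (A \<omega>), c (A \<omega>) + R (A \<omega>)]\<close>, where \<open>A \<omega>\<close> ranges over countably many sites. Two independent copies fall
  into one of three cases. If their original distance is at least \<open>t\<close>, the displacement \<open>h\<close> is small in
  comparison and the kernel grows at most by the factor \<open>(1 + \<beta>)\<^sup>2\<close>. If it is smaller but the sites differ, the
  kernel is at most \<open>L\<^sup>2\<close> by the separation of the sites, and this has probability at most \<open>\<theta>\<close>. If the sites
  agree, the energy of the common interval is weighted by the probability of hitting the site again,
  which \<open>\<eta>\<close> controls. The constant 130 is \<open>2 * 65\<close>, where 65 bounds the potential of the uniform
  distribution on the unit interval.\<close>
theorem energy_of_discretised_measure:
  fixes \<Omega> :: "'w measure" and X :: "'w \<Rightarrow> real" and A :: "'w \<Rightarrow> 'a::countable" and c R :: "'a \<Rightarrow> real"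
  assumes "prob_space \<Omega>" and X [measurable]: "X \<in> borel_measurable \<Omega>"
    and A [measurable]: "A \<in> \<Omega> \<rightarrow>\<^sub>M count_space UNIV"
    and conc: "\<And>x. emeasure \<Omega> {\<omega>\<in>space \<Omega>. \<bar>x - X \<omega>\<bar> < t} \<le> ennreal \<theta>"
    and disp: "\<And>\<omega>. \<omega> \<in> space \<Omega> \<Longrightarrow> \<bar>X \<omega> - c (A \<omega>)\<bar> \<le> h"
    and R: "\<And>\<omega>. \<omega> \<in> space \<Omega> \<Longrightarrow> 0 < R (A \<omega>) \<and> R (A \<omega>) \<le> h \<and> R (A \<omega>) \<le> 1"
    and \<beta>: "0 < \<beta>" and t: "0 < t" and h: "4 * h \<le> (1 - exp (- \<beta>)) * t"
    and sep: "\<And>\<omega> \<omega>'. \<omega> \<in> space \<Omega> \<Longrightarrow> \<omega>' \<in> space \<Omega> \<Longrightarrow> A \<omega> \<noteq> A \<omega>' \<Longrightarrow>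
        R (A \<omega>) + R (A \<omega>') + exp (- L) \<le> \<bar>c (A \<omega>) - c (A \<omega>')\<bar>"
    and L: "1 \<le> L"
    and atom: "\<And>\<omega>. \<omega> \<in> space \<Omega> \<Longrightarrow>
        emeasure \<Omega> {\<omega>'\<in>space \<Omega>. A \<omega>' = A \<omega>} * ennreal (130 + 2 * (ln (R (A \<omega>)))\<^sup>2) \<le> ennreal \<eta>"
  shows "sq_energy (distr (\<Omega> \<Otimes>\<^sub>M unif01) borel (\<lambda>(\<omega>, u). c (A \<omega>) + R (A \<omega>) * u))
    \<le> ennreal ((1 + \<beta>)\<^sup>2) * sq_energy (distr \<Omega> borel X) + ennreal (L\<^sup>2) * ennreal \<theta> + ennreal \<eta>"
proof -
  interpret \<Omega>: prob_space \<Omega> by fact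
  interpret U: prob_space unif01 by (rule prob_space_unif01)
  interpret P: pair_prob_space \<Omega> unif01 ..
  have [measurable]: "(\<lambda>\<omega>. c (A \<omega>)) \<in> borel_measurable \<Omega>" "(\<lambda>\<omega>. R (A \<omega>)) \<in> borel_measurable \<Omega>"
    by (rule measurable_compose[OF A]; simp)+
  define Y where "Y = (\<lambda>(\<omega>, u). c (A \<omega>) + R (A \<omega>) * u)"
  have [measurable]: "Y \<in> borel_measurable (\<Omega> \<Otimes>\<^sub>M unif01)"
    unfolding Y_def by measurable
  define T where "T \<omega> u \<omega>' u' =
      ennreal ((1 + \<beta>)\<^sup>2) * radial_kernel 2 \<bar>X \<omega> - X \<omega>'\<bar>
      + ennreal (L\<^sup>2) * indicator {\<omega>'\<in>space \<Omega>. \<bar>X \<omega> - X \<omega>'\<bar> < t} \<omega>'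
      + indicator {\<omega>'\<in>space \<Omega>. A \<omega>' = A \<omega>} \<omega>'
        * (2 * radial_kernel 2 \<bar>u - u'\<bar> + ennreal (2 * (ln (R (A \<omega>)))\<^sup>2))" for \<omega> u \<omega>' u'
  have bound: "radial_kernel 2 \<bar>Y (\<omega>, u) - Y (\<omega>', u')\<bar> \<le> T \<omega> u \<omega>' u'"
    if w: "\<omega> \<in> space \<Omega>" "\<omega>' \<in> space \<Omega>" and u: "0 \<le> u \<and> u \<le> 1" "0 \<le> u' \<and> u' \<le> 1" for \<omega> u \<omega>' u'
  proof (cases "A \<omega>' = A \<omega>")
    case True
    then have "Y (\<omega>, u) - Y (\<omega>', u') = R (A \<omega>) * (u - u')" by (simp add: Y_def algebra_simps)
    then have "\<bar>Y (\<omega>, u) - Y (\<omega>', u')\<bar> = R (A \<omega>) * \<bar>u - u'\<bar>" using R[OF w(1)] by (simp add: abs_mult)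
    then have "radial_kernel 2 \<bar>Y (\<omega>, u) - Y (\<omega>', u')\<bar>
        \<le> 2 * radial_kernel 2 \<bar>u - u'\<bar> + ennreal (2 * (ln (R (A \<omega>)))\<^sup>2)"
      using R[OF w(1)] radial_kernel_two_scale[of "R (A \<omega>)" "\<bar>u - u'\<bar>"] by simp
    also have "\<dots> \<le> T \<omega> u \<omega>' u'" unfolding T_def using True w by simp
    finally show ?thesis .
  next
    case False
    have Yc: "c (A \<omega>) \<le> Y (\<omega>, u)" "Y (\<omega>, u) \<le> c (A \<omega>) + R (A \<omega>)"
      if "\<omega> \<in> space \<Omega>" "0 \<le> u \<and> u \<le> 1" for \<omega> u
      using that R[OF that(1)] mult_left_le[of u "R (A \<omega>)"] by (auto simp: Y_def)
    note Y1 = Yc[OF w(1) u(1)] and Y2 = Yc[OF w(2) u(2)]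
    show ?thesis
    proof (cases "\<bar>X \<omega> - X \<omega>'\<bar> < t")
      case True
      have "exp (- L) \<le> \<bar>Y (\<omega>, u) - Y (\<omega>', u')\<bar>"
        using sep[OF w] False Y1 Y2 by fastforce
      then have "radial_kernel 2 \<bar>Y (\<omega>, u) - Y (\<omega>', u')\<bar> \<le> radial_kernel 2 (exp (- L))"
        by (intro radial_kernel_antimono) auto
      also have "\<dots> = ennreal (L\<^sup>2)" using L by (simp add: radial_kernel_two max_def)
      also have "\<dots> \<le> T \<omega> u \<omega>' u'" unfolding T_def using True w by (simp add: add_increasing2 add_increasing)
      finally show ?thesis .
    next
      case far: False
      have "\<bar>X \<omega> - X \<omega>'\<bar> - 4 * h \<le> \<bar>Y (\<omega>, u) - Y (\<omega>', u')\<bar>"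
        using Y1 Y2 R[OF w(1)] R[OF w(2)] disp[OF w(1)] disp[OF w(2)] by linarith
      moreover have "(1 - exp (- \<beta>)) * t \<le> (1 - exp (- \<beta>)) * \<bar>X \<omega> - X \<omega>'\<bar>"
        using far \<beta> by (intro mult_left_mono) auto
      ultimately have "exp (- \<beta>) * \<bar>X \<omega> - X \<omega>'\<bar> \<le> \<bar>Y (\<omega>, u) - Y (\<omega>', u')\<bar>"
        using h by (simp add: algebra_simps)
      then have "radial_kernel 2 \<bar>Y (\<omega>, u) - Y (\<omega>', u')\<bar> \<le> ennreal ((1 + \<beta>)\<^sup>2) * radial_kernel 2 \<bar>X \<omega> - X \<omega>'\<bar>"
        using far t \<beta> by (intro radial_kernel_two_contract) auto
      also have "\<dots> \<le> T \<omega> u \<omega>' u'" unfolding T_def by (simp add: add_increasing2)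
      finally show ?thesis .
    qed
  qed
  have inner: "(\<integral>\<^sup>+ z. radial_kernel 2 \<bar>Y (\<omega>, u) - Y z\<bar> \<partial>(\<Omega> \<Otimes>\<^sub>M unif01))
      \<le> ennreal ((1 + \<beta>)\<^sup>2) * (\<integral>\<^sup>+ \<omega>'. radial_kernel 2 \<bar>X \<omega> - X \<omega>'\<bar> \<partial>\<Omega>) + ennreal (L\<^sup>2) * ennreal \<theta> + ennreal \<eta>"
    if w: "\<omega> \<in> space \<Omega>" and u: "0 \<le> u \<and> u \<le> 1" for \<omega> u
  proof -
    have "(\<integral>\<^sup>+ z. radial_kernel 2 \<bar>Y (\<omega>, u) - Y z\<bar> \<partial>(\<Omega> \<Otimes>\<^sub>M unif01))
        = (\<integral>\<^sup>+ \<omega>'. \<integral>\<^sup>+ u'. radial_kernel 2 \<bar>Y (\<omega>, u) - Y (\<omega>', u')\<bar> \<partial>unif01 \<partial>\<Omega>)"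
      by (subst U.nn_integral_fst[symmetric]) auto
    also have "\<dots> \<le> (\<integral>\<^sup>+ \<omega>'. \<integral>\<^sup>+ u'. T \<omega> u \<omega>' u' \<partial>unif01 \<partial>\<Omega>)"
    proof (rule nn_integral_mono, rule nn_integral_mono_AE)
      fix \<omega>' assume "\<omega>' \<in> space \<Omega>"
      show "AE u' in unif01. radial_kernel 2 \<bar>Y (\<omega>, u) - Y (\<omega>', u')\<bar> \<le> T \<omega> u \<omega>' u'"
        using AE_unif01 by eventually_elim (use bound w u \<open>\<omega>' \<in> space \<Omega>\<close> in auto)
    qed
    also have "\<dots> = (\<integral>\<^sup>+ \<omega>'. ennreal ((1 + \<beta>)\<^sup>2) * radial_kernel 2 \<bar>X \<omega> - X \<omega>'\<bar>
      + ennreal (L\<^sup>2) * indicator {\<omega>'\<in>space \<Omega>. \<bar>X \<omega> - X \<omega>'\<bar> < t} \<omega>'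
      + (2 * (\<integral>\<^sup>+ u'. radial_kernel 2 \<bar>u - u'\<bar> \<partial>unif01) + ennreal (2 * (ln (R (A \<omega>)))\<^sup>2))
        * indicator {\<omega>'\<in>space \<Omega>. A \<omega>' = A \<omega>} \<omega>' \<partial>\<Omega>)"
      unfolding T_def
      by (intro nn_integral_cong)
         (simp add: nn_integral_add nn_integral_cmult U.emeasure_space_1[simplified] mult.commute[of _ "indicator _ _"])
    also have "\<dots> = ennreal ((1 + \<beta>)\<^sup>2) * (\<integral>\<^sup>+ \<omega>'. radial_kernel 2 \<bar>X \<omega> - X \<omega>'\<bar> \<partial>\<Omega>)
      + ennreal (L\<^sup>2) * emeasure \<Omega> {\<omega>'\<in>space \<Omega>. \<bar>X \<omega> - X \<omega>'\<bar> < t}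
      + (2 * (\<integral>\<^sup>+ u'. radial_kernel 2 \<bar>u - u'\<bar> \<partial>unif01) + ennreal (2 * (ln (R (A \<omega>)))\<^sup>2))
        * emeasure \<Omega> {\<omega>'\<in>space \<Omega>. A \<omega>' = A \<omega>}"
      by (subst nn_integral_add; measurable?)+ (simp add: nn_integral_cmult nn_integral_cmult_indicator)
    also have "\<dots> \<le> ennreal ((1 + \<beta>)\<^sup>2) * (\<integral>\<^sup>+ \<omega>'. radial_kernel 2 \<bar>X \<omega> - X \<omega>'\<bar> \<partial>\<Omega>) + ennreal (L\<^sup>2) * ennreal \<theta> + ennreal \<eta>"
    proof (intro add_mono mult_left_mono conc order_refl)
      have "(\<integral>\<^sup>+ u'. radial_kernel 2 \<bar>u - u'\<bar> \<partial>unif01) \<le> 65"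
        using potential_le_of_density_bounded[OF density_bounded_unif01 prob_space_unif01, of u] by simp
      then have "2 * (\<integral>\<^sup>+ u'. radial_kernel 2 \<bar>u - u'\<bar> \<partial>unif01) + ennreal (2 * (ln (R (A \<omega>)))\<^sup>2)
          \<le> 2 * 65 + ennreal (2 * (ln (R (A \<omega>)))\<^sup>2)" by (intro add_mono mult_left_mono) auto
      also have "\<dots> = ennreal (130 + 2 * (ln (R (A \<omega>)))\<^sup>2)" by simp
      finally show "(2 * (\<integral>\<^sup>+ u'. radial_kernel 2 \<bar>u - u'\<bar> \<partial>unif01) + ennreal (2 * (ln (R (A \<omega>)))\<^sup>2))
        * emeasure \<Omega> {\<omega>'\<in>space \<Omega>. A \<omega>' = A \<omega>} \<le> ennreal \<eta>"
        using atom[OF w] by (subst mult.commute) (meson mult_left_mono order_trans zero_le)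
    qed auto
    finally show ?thesis .
  qed
  have "sq_energy (distr (\<Omega> \<Otimes>\<^sub>M unif01) borel Y)
      = (\<integral>\<^sup>+ z. \<integral>\<^sup>+ z'. radial_kernel 2 \<bar>Y z - Y z'\<bar> \<partial>(\<Omega> \<Otimes>\<^sub>M unif01) \<partial>(\<Omega> \<Otimes>\<^sub>M unif01))"
  proof -
    have "(\<lambda>x. \<integral>\<^sup>+ z'. radial_kernel 2 \<bar>x - Y z'\<bar> \<partial>(\<Omega> \<Otimes>\<^sub>M unif01)) \<in> borel_measurable borel"
      by (rule P.P.borel_measurable_nn_integral) measurable
    then show ?thesis
      unfolding sq_energy_def by (simp add: nn_integral_distr)
  qed
  also have "\<dots> = (\<integral>\<^sup>+ \<omega>. \<integral>\<^sup>+ u. \<integral>\<^sup>+ z'. radial_kernel 2 \<bar>Y (\<omega>, u) - Y z'\<bar> \<partial>(\<Omega> \<Otimes>\<^sub>M unif01) \<partial>unif01 \<partial>\<Omega>)"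
    by (subst U.nn_integral_fst[symmetric]) auto
  also have "\<dots> \<le> (\<integral>\<^sup>+ \<omega>. \<integral>\<^sup>+ u. ennreal ((1 + \<beta>)\<^sup>2) * (\<integral>\<^sup>+ \<omega>'. radial_kernel 2 \<bar>X \<omega> - X \<omega>'\<bar> \<partial>\<Omega>)
      + ennreal (L\<^sup>2) * ennreal \<theta> + ennreal \<eta> \<partial>unif01 \<partial>\<Omega>)"
  proof (rule nn_integral_mono, rule nn_integral_mono_AE)
    fix \<omega> assume w: "\<omega> \<in> space \<Omega>"
    show "AE u in unif01. (\<integral>\<^sup>+ z'. radial_kernel 2 \<bar>Y (\<omega>, u) - Y z'\<bar> \<partial>(\<Omega> \<Otimes>\<^sub>M unif01))
      \<le> ennreal ((1 + \<beta>)\<^sup>2) * (\<integral>\<^sup>+ \<omega>'. radial_kernel 2 \<bar>X \<omega> - X \<omega>'\<bar> \<partial>\<Omega>) + ennreal (L\<^sup>2) * ennreal \<theta> + ennreal \<eta>"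
      using AE_unif01 by eventually_elim (rule inner[OF w])
  qed
  also have "\<dots> = ennreal ((1 + \<beta>)\<^sup>2) * (\<integral>\<^sup>+ \<omega>. \<integral>\<^sup>+ \<omega>'. radial_kernel 2 \<bar>X \<omega> - X \<omega>'\<bar> \<partial>\<Omega> \<partial>\<Omega>)
      + ennreal (L\<^sup>2) * ennreal \<theta> + ennreal \<eta>"
    by (simp add: U.emeasure_space_1[simplified] nn_integral_add nn_integral_cmult \<Omega>.emeasure_space_1)
  also have "(\<integral>\<^sup>+ \<omega>. \<integral>\<^sup>+ \<omega>'. radial_kernel 2 \<bar>X \<omega> - X \<omega>'\<bar> \<partial>\<Omega> \<partial>\<Omega>) = sq_energy (distr \<Omega> borel X)"
  proof -
    have "(\<lambda>x. \<integral>\<^sup>+ \<omega>. radial_kernel 2 \<bar>x - X \<omega>\<bar> \<partial>\<Omega>) \<in> borel_measurable borel" by measurable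
    then show ?thesis unfolding sq_energy_def by (simp add: nn_integral_distr)
  qed
  finally show ?thesis unfolding Y_def .
qed

section \<open>Random rational approximations on many scales\<close>

definition is_dirichlet_pair :: "nat \<Rightarrow> real \<Rightarrow> int \<times> int \<Rightarrow> bool" where
  "is_dirichlet_pair N x = (\<lambda>(p, q). coprime p q \<and> 0 < q \<and> q \<le> int N \<and> \<bar>of_int q * x - of_int p\<bar> < 1 / real N)"

text \<open>Taking the first approximation in an enumeration of all pairs, rather than an arbitrary one, makes the
  choice measurable in \<open>x\<close>.\<close>
definition dirichlet_pair :: "nat \<Rightarrow> real \<Rightarrow> int \<times> int" where
  "dirichlet_pair N x = from_nat (LEAST i. is_dirichlet_pair N x (from_nat i))"

lemma dirichlet_pair:
  assumes "0 < N"
  shows "is_dirichlet_pair N x (dirichlet_pair N x)"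
proof -
  obtain p q where "coprime p q" "0 < q" "q \<le> int N" "\<bar>of_int q * x - of_int p\<bar> < 1 / real N"
    using Dirichlet_approx_coprime[OF assms, of x] by blast
  then have "is_dirichlet_pair N x (from_nat (to_nat (p, q)))" by (simp add: is_dirichlet_pair_def)
  then show ?thesis unfolding dirichlet_pair_def by (rule LeastI)
qed

lemma measurable_dirichlet_pair [measurable]:
  "dirichlet_pair N \<in> borel \<rightarrow>\<^sub>M count_space UNIV"
proof -
  have "Measurable.pred borel (\<lambda>x. is_dirichlet_pair N x (from_nat i))" for i
    unfolding is_dirichlet_pair_def by (cases "from_nat i :: int \<times> int") (simp, measurable)
  then have "(\<lambda>x. LEAST i. is_dirichlet_pair N x (from_nat i)) \<in> borel \<rightarrow>\<^sub>M count_space UNIV"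
    by (rule measurable_Least)
  then show ?thesis unfolding dirichlet_pair_def
    by (rule measurable_compose) simp
qed

lemma dirichlet_pair_close:
  assumes "0 < N" "dirichlet_pair N x = (p, q)"
  shows "0 < q" "q \<le> int N" "\<bar>x - p / q\<bar> < 1 / (real_of_int q * real N)"
proof -
  have *: "0 < q" "q \<le> int N" "\<bar>of_int q * x - of_int p\<bar> < 1 / real N"
    using dirichlet_pair[OF assms(1), of x] by (auto simp: assms(2) is_dirichlet_pair_def)
  then show "0 < q" "q \<le> int N" by auto
  have "\<bar>x - p / q\<bar> = \<bar>of_int q * x - of_int p\<bar> / q"
    using *(1) by (simp add: field_simps flip: abs_divide) (simp add: abs_divide)
  also have "\<dots> < 1 / real N / q" using *(1,3) by (intro divide_strict_right_mono) auto
  finally show "\<bar>x - p / q\<bar> < 1 / (real_of_int q * real N)" by (simp add: mult.commute)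
qed

lemma coprime_fractions_apart:
  fixes p q p' q' :: int
  assumes "coprime p q" "coprime p' q'" "0 < q" "0 < q'" "(p, q) \<noteq> (p', q')"
  shows "1 / (real_of_int q * real_of_int q') \<le> \<bar>p / q - p' / q'\<bar>"
proof -
  have "p * q' \<noteq> p' * q"
  proof
    assume eq: "p * q' = p' * q"
    have "q dvd q'" using eq assms(1) by (metis coprime_commute coprime_dvd_mult_right_iff dvd_triv_right)
    moreover have "q' dvd q" using eq assms(2) by (metis coprime_commute coprime_dvd_mult_right_iff dvd_triv_right)
    ultimately have "q = q'" using assms(3,4) by (simp add: zdvd_antisym_nonneg)
    then show False using eq assms by simp
  qed
  then have "1 \<le> \<bar>p * q' - p' * q\<bar>" by linarith
  then have "1 \<le> \<bar>real_of_int p * q' - real_of_int p' * q\<bar>" by (simp flip: of_int_mult of_int_diff of_int_abs)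
  moreover have "p / q - p' / q' = (real_of_int p * q' - real_of_int p' * q) / (real_of_int q * q')"
    using assms by (simp add: field_simps)
  ultimately show ?thesis using assms by (simp add: abs_divide abs_mult divide_right_mono)
qed

text \<open>Only points within \<open>1 / (q N)\<close> of \<open>p / q\<close> are sent there, and none if \<open>q > N\<close>.\<close>
lemma emeasure_dirichlet_pair_le:
  assumes D: "density_bounded_by D \<mu>" and N: "0 < N"
  shows "emeasure \<mu> {x. dirichlet_pair N x = (p, q)}
    \<le> ennreal (if 0 < q \<and> q \<le> int N then 2 * D / (real_of_int q * real N) else 0)"
proof (cases "0 < q \<and> q \<le> int N")
  case True
  have D': "sets \<mu> = sets borel" "0 \<le> D" using D by (auto simp: density_bounded_by_def)
  let ?r = "1 / (real_of_int q * real N)"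
  have "emeasure \<mu> {x. dirichlet_pair N x = (p, q)} \<le> emeasure \<mu> {p / q - ?r..p / q + ?r}"
    using dirichlet_pair_close(3)[OF N] D'(1)
    by (intro emeasure_mono) (force simp: abs_less_iff)+
  also have "\<dots> \<le> ennreal D * emeasure lborel {p / q - ?r..p / q + ?r}"
    using D by (simp add: density_bounded_by_def)
  also have "\<dots> = ennreal D * ennreal (2 * ?r)" using True N by simp
  also have "\<dots> = ennreal (2 * D / (real_of_int q * real N))"
    using D' True by (subst ennreal_mult'[symmetric]) auto
  finally show ?thesis using True by simp
next
  case False
  then have "{x. dirichlet_pair N x = (p, q)} = {}" using dirichlet_pair_close(1,2)[OF N] by auto
  then show ?thesis by (simp only: emeasure_empty) simp
qed

text \<open>The first nonzero term is at most \<open>1 / q\<close> and each further one halves.\<close>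
lemma geometric_tail_sum_le:
  assumes "0 < q" "0 < Q"
  shows "(\<Sum>j<M. if q \<le> 2 ^ j * Q then 1 / (2 ^ j * Q) else 0) \<le> 2 / (q::real)"
  using assms
proof (induction M arbitrary: Q)
  case (Suc M)
  have *: "(\<Sum>j<M. if q \<le> 2 ^ Suc j * Q then 1 / (2 ^ Suc j * Q) else 0) \<le> 2 / q"
  proof -
    have eq: "2 ^ Suc j * Q = 2 ^ j * (2 * Q)" for j :: nat by simp
    show ?thesis unfolding eq by (rule Suc.IH) (use Suc.prems in auto)
  qed
  show ?case
  proof (cases "q \<le> Q")
    case True
    have "(\<Sum>j<Suc M. if q \<le> 2 ^ j * Q then 1 / (2 ^ j * Q) else 0) \<le> (\<Sum>j<Suc M. (1/2) ^ j / Q)"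
      using Suc.prems by (intro sum_mono) (auto simp: power_one_over divide_simps)
    also have "\<dots> = (\<Sum>j<Suc M. (1/2) ^ j) / Q" by (simp only: sum_divide_distrib)
    also have "\<dots> \<le> 2 / Q"
    proof (intro divide_right_mono)
      have "(\<Sum>j<Suc M. (1/2::real) ^ j) \<le> (\<Sum>j. (1/2) ^ j)"
        by (intro sum_le_suminf summable_geometric) auto
      then show "(\<Sum>j<Suc M. (1/2::real) ^ j) \<le> 2" by (simp add: suminf_geometric)
    qed (use Suc.prems in auto)
    also have "\<dots> \<le> 2 / q" using True Suc.prems by (intro divide_left_mono) auto
    finally show ?thesis .
  next
    case False
    then show ?thesis using * by (subst sum.lessThan_Suc_shift) auto
  qed
qed simp

text \<open>The scale index \<open>j\<close> is capped at \<open>M\<close> so that the denominators are bounded by \<open>2 ^ M * Q\<close> for every \<open>j\<close>, not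
  just with probability 1.\<close>
definition random_dirichlet_pair :: "nat \<Rightarrow> nat \<Rightarrow> nat \<times> real \<Rightarrow> int \<times> int" where
  "random_dirichlet_pair M Q = (\<lambda>(j, x). dirichlet_pair (2 ^ min j M * Q) x)"

definition random_scale :: "nat \<Rightarrow> real measure \<Rightarrow> (nat \<times> real) measure" where
  "random_scale M \<mu> = measure_pmf (pmf_of_set {..<M}) \<Otimes>\<^sub>M \<mu>"

lemma measurable_random_dirichlet_pair [measurable]:
  assumes [measurable_cong]: "sets \<mu> = sets borel"
  shows "random_dirichlet_pair M Q \<in> random_scale M \<mu> \<rightarrow>\<^sub>M count_space UNIV"
proof -
  have "(\<lambda>z. dirichlet_pair (2 ^ min (fst z) M * Q) (snd z)) \<in> count_space UNIV \<Otimes>\<^sub>M \<mu> \<rightarrow>\<^sub>M count_space UNIV"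
    by (rule measurable_compose_countable[where g = fst and f = "\<lambda>j z. dirichlet_pair (2 ^ min j M * Q) (snd z)"])
       measurable
  also have "count_space UNIV \<Otimes>\<^sub>M \<mu> \<rightarrow>\<^sub>M count_space UNIV = random_scale M \<mu> \<rightarrow>\<^sub>M count_space UNIV"
    unfolding random_scale_def by (intro measurable_cong_sets sets_pair_measure_cong) auto
  finally show ?thesis by (simp add: random_dirichlet_pair_def case_prod_unfold)
qed

text \<open>Averaging over the scales \<open>2 ^ j * Q\<close>, each of which gives \<open>p / q\<close> mass at most \<open>2 D / (q * 2 ^ j * Q)\<close> and
  contributes only when it is at least \<open>q\<close>. The factor \<open>1 / M\<close> in the second bound is the gain from
  using many scales.\<close>
lemma emeasure_random_dirichlet_pair_le:
  fixes p q :: int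
  assumes D: "density_bounded_by D \<mu>" and "prob_space \<mu>" and M: "0 < M" and Q: "0 < Q" and q: "0 < q"
  defines "m \<equiv> emeasure (random_scale M \<mu>) {z \<in> space (random_scale M \<mu>). random_dirichlet_pair M Q z = (p, q)}"
  shows "m \<le> ennreal (2 * D / Q)" "m \<le> ennreal (4 * D / (M * (real_of_int q)\<^sup>2))"
proof -
  interpret prob_space \<mu> by fact
  have sets [measurable_cong]: "sets \<mu> = sets borel" and D0: "0 \<le> D" using D by (auto simp: density_bounded_by_def)
  have sp: "space \<mu> = UNIV" using sets_eq_imp_space_eq[OF sets] by simp
  define b where "b j = (if real_of_int q \<le> 2 ^ j * real Q then 1 / (2 ^ j * real Q) else 0)" for j
  have "random_dirichlet_pair M Q -` {(p, q)} \<inter> space (random_scale M \<mu>) \<in> sets (random_scale M \<mu>)"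
    by (rule measurable_sets[OF measurable_random_dirichlet_pair[OF sets]]) simp
  also have "random_dirichlet_pair M Q -` {(p, q)} \<inter> space (random_scale M \<mu>)
      = {z \<in> space (random_scale M \<mu>). random_dirichlet_pair M Q z = (p, q)}" by auto
  finally have in_sets: "\<dots> \<in> sets (random_scale M \<mu>)" .
  have "m = (\<integral>\<^sup>+ j. emeasure \<mu> {x. dirichlet_pair (2 ^ min j M * Q) x = (p, q)} \<partial>measure_pmf (pmf_of_set {..<M}))"
    unfolding m_def random_scale_def
    by (subst emeasure_pair_measure_alt[OF in_sets[unfolded random_scale_def]])
       (simp add: random_dirichlet_pair_def space_pair_measure sp vimage_def)
  also have "\<dots> = (\<Sum>j<M. emeasure \<mu> {x. dirichlet_pair (2 ^ j * Q) x = (p, q)}) / M"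
    using M by (subst nn_integral_pmf_of_set) (auto intro!: sum.cong arg_cong2[where f = divide])
  also have "\<dots> \<le> (\<Sum>j<M. ennreal (2 * D / q * b j)) / M"
  proof (intro divide_right_mono_ennreal sum_mono)
    fix j
    have "q \<le> int (2 ^ j * Q) \<longleftrightarrow> real_of_int q \<le> 2 ^ j * real Q"
      by (subst of_int_le_iff[where 'a = real, symmetric]) simp
    then show "emeasure \<mu> {x. dirichlet_pair (2 ^ j * Q) x = (p, q)} \<le> ennreal (2 * D / q * b j)"
      using emeasure_dirichlet_pair_le[OF D, of "2 ^ j * Q" p q] Q q by (auto simp: b_def mult.commute)
  qed
  also have "\<dots> = ennreal ((\<Sum>j<M. 2 * D / q * b j) / M)"
  proof -
    have nonneg: "0 \<le> 2 * D / q * b j" for j using D0 q by (simp add: b_def)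
    then have "(\<Sum>j<M. ennreal (2 * D / q * b j)) = ennreal (\<Sum>j<M. 2 * D / q * b j)"
      by (intro sum_ennreal)
    moreover have "0 \<le> (\<Sum>j<M. 2 * D / q * b j)" using nonneg by (rule sum_nonneg)
    ultimately show ?thesis
      using M by (simp only: ennreal_of_nat_eq_real_of_nat) (subst divide_ennreal, auto)
  qed
  finally have m: "m \<le> ennreal (2 * D / q * (\<Sum>j<M. b j) / M)" by (simp add: sum_distrib_left)
  have q1: "1 \<le> real_of_int q" using q by linarith
  have "(\<Sum>j<M. b j) \<le> (\<Sum>j<M. 1 / real Q)"
    using Q by (intro sum_mono) (auto simp: b_def intro!: divide_left_mono)
  then have "2 * D / q * (\<Sum>j<M. b j) / M \<le> 2 * D / q * (M * (1 / Q)) / M"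
    using D0 q by (intro divide_right_mono mult_left_mono) auto
  also have "\<dots> = 2 * D / Q / q" using M by simp
  also have "\<dots> \<le> 2 * D / Q" using divide_left_mono[of 1 "real_of_int q" "2 * D / Q"] q1 D0 by simp
  finally show "m \<le> ennreal (2 * D / Q)" using m by (meson ennreal_leI order_trans)
  have "(\<Sum>j<M. b j) \<le> 2 / q"
    unfolding b_def using geometric_tail_sum_le[of "real_of_int q" "real Q" M] q Q by simp
  then have "2 * D / q * (\<Sum>j<M. b j) / M \<le> 2 * D / q * (2 / q) / M"
    using D0 q by (intro divide_right_mono mult_left_mono) auto
  also have "\<dots> = 4 * D / (M * (real_of_int q)\<^sup>2)" by (simp add: power2_eq_square)
  finally show "m \<le> ennreal (4 * D / (M * (real_of_int q)\<^sup>2))" using m by (meson ennreal_leI order_trans)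
qed

text \<open>Spreading each atom uniformly over an interval restores a bounded density, which allows the
  construction to be iterated.\<close>
lemma density_bounded_smoothing:
  fixes \<Omega> :: "'w measure" and c R :: "'w \<Rightarrow> real"
  assumes "prob_space \<Omega>" and [measurable]: "c \<in> borel_measurable \<Omega>" "R \<in> borel_measurable \<Omega>"
    and \<rho>: "0 < \<rho>" "\<And>\<omega>. \<omega> \<in> space \<Omega> \<Longrightarrow> \<rho> \<le> R \<omega>"
  shows "density_bounded_by (1 / \<rho>) (distr (\<Omega> \<Otimes>\<^sub>M unif01) borel (\<lambda>(\<omega>, u). c \<omega> + R \<omega> * u))"
  unfolding density_bounded_by_def
proof (intro conjI ballI)
  interpret \<Omega>: prob_space \<Omega> by fact
  interpret U: prob_space unif01 by (rule prob_space_unif01)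
  fix S :: "real set" assume [measurable]: "S \<in> sets borel"
  let ?Y = "\<lambda>(\<omega>, u). c \<omega> + R \<omega> * u"
  have "emeasure (distr (\<Omega> \<Otimes>\<^sub>M unif01) borel ?Y) S = (\<integral>\<^sup>+ y. indicator S y \<partial>distr (\<Omega> \<Otimes>\<^sub>M unif01) borel ?Y)"
    by simp
  also have "\<dots> = (\<integral>\<^sup>+ z. indicator S (?Y z) \<partial>(\<Omega> \<Otimes>\<^sub>M unif01))"
    by (rule nn_integral_distr) measurable
  also have "\<dots> = (\<integral>\<^sup>+ \<omega>. \<integral>\<^sup>+ u. indicator S (c \<omega> + R \<omega> * u) \<partial>unif01 \<partial>\<Omega>)"
    by (subst U.nn_integral_fst[symmetric]) auto
  also have "\<dots> \<le> (\<integral>\<^sup>+ \<omega>. ennreal (1 / \<rho>) * emeasure lborel S \<partial>\<Omega>)"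
  proof (rule nn_integral_mono)
    fix \<omega> assume w: "\<omega> \<in> space \<Omega>"
    then have R: "0 < R \<omega>" "\<rho> \<le> R \<omega>" using \<rho> by force+
    have "(\<integral>\<^sup>+ u. indicator S (c \<omega> + R \<omega> * u) \<partial>unif01) \<le> ennreal 1 * (\<integral>\<^sup>+ u. indicator S (c \<omega> + R \<omega> * u) \<partial>lborel)"
      by (intro nn_integral_density_bounded_le[OF density_bounded_unif01]) measurable
    also have "\<dots> = ennreal (1 / R \<omega>) * (ennreal \<bar>R \<omega>\<bar> * (\<integral>\<^sup>+ u. indicator S (c \<omega> + R \<omega> * u) \<partial>lborel))"
      using R by (simp flip: mult.assoc ennreal_mult')
    also have "ennreal \<bar>R \<omega>\<bar> * (\<integral>\<^sup>+ u. indicator S (c \<omega> + R \<omega> * u) \<partial>lborel) = emeasure lborel S"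
      using R by (subst nn_integral_real_affine[symmetric]) auto
    also have "ennreal (1 / R \<omega>) * emeasure lborel S \<le> ennreal (1 / \<rho>) * emeasure lborel S"
      using R \<rho> by (intro mult_right_mono ennreal_leI divide_left_mono) auto
    finally show "(\<integral>\<^sup>+ u. indicator S (c \<omega> + R \<omega> * u) \<partial>unif01) \<le> ennreal (1 / \<rho>) * emeasure lborel S" .
  qed
  also have "\<dots> = ennreal (1 / \<rho>) * emeasure lborel S" by (simp add: \<Omega>.emeasure_space_1)
  finally show "emeasure (distr (\<Omega> \<Otimes>\<^sub>M unif01) borel ?Y) S \<le> ennreal (1 / \<rho>) * emeasure lborel S" .
qed (use \<rho> in auto)

section \<open>Concentrating a measure near the rationals\<close>

text \<open>By the approximation criterion above, a point that lies in these sets for all \<open>n\<close> is not a Brjuno number.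
  The factor \<open>n\<close> in the exponent is what beats any bound on the terms of the Brjuno series.\<close>
definition near_rationals :: "nat \<Rightarrow> real set" where
  "near_rationals n = {x. \<exists>(p::int) (q::int). (0::int) < q \<and> \<bar>x - p / q\<bar> < exp (- (real n * q))}"

lemma distr_snd_random_scale:
  assumes "prob_space \<mu>" and sets [measurable_cong]: "sets \<mu> = sets borel"
  shows "distr (random_scale M \<mu>) borel snd = \<mu>"
proof (rule measure_eqI)
  interpret prob_space \<mu> by fact
  fix S assume "S \<in> sets (distr (random_scale M \<mu>) borel snd)"
  then have S [measurable]: "S \<in> sets borel" by simp
  have sp: "space \<mu> = UNIV" using sets_eq_imp_space_eq[OF sets] by simp
  have "emeasure (distr (random_scale M \<mu>) borel snd) S = emeasure (random_scale M \<mu>) (UNIV \<times> S)"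
    unfolding random_scale_def
    by (subst emeasure_distr) (auto simp: space_pair_measure sp intro!: arg_cong2[where f = emeasure])
  also have "\<dots> = emeasure (measure_pmf (pmf_of_set {..<M})) UNIV * emeasure \<mu> S"
    unfolding random_scale_def by (rule emeasure_pair_measure_Times) (auto simp: sets)
  finally show "emeasure (distr (random_scale M \<mu>) borel snd) S = emeasure \<mu> S"
    by (simp add: measure_pmf.emeasure_space_1[simplified])
qed (simp add: sets)

lemma prob_space_random_scale:
  assumes "prob_space \<mu>"
  shows "prob_space (random_scale M \<mu>)"
proof -
  interpret prob_space \<mu> by fact
  interpret pair_prob_space "measure_pmf (pmf_of_set {..<M})" \<mu> ..
  show ?thesis unfolding random_scale_def by (rule prob_space_axioms)
qed

text \<open>One step of the construction. The number \<open>M\<close> of scales is chosen first, to make the self-energy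
  \<open>16 n\<^sup>2 D / M\<close> small; afterwards the smallest scale \<open>Q\<close> is taken so large that the remaining errors, which
  are of order \<open>(ln Q)\<^sup>2 / \<surd>Q\<close> for fixed \<open>M\<close>, are small too. The strict inequality for the energy is what leaves
  room for these errors.\<close>
theorem exists_measure_near_rationals:
  fixes \<mu> :: "real measure" and n :: nat
  assumes D: "density_bounded_by D \<mu>" and "prob_space \<mu>"
    and K: "compact K" "open V" "K \<subseteq> V" "emeasure \<mu> (- K) = 0"
    and energy: "sq_energy \<mu> < ennreal B"
  obtains D' \<nu> K' where "density_bounded_by D' \<nu>" "prob_space \<nu>"
    "compact K'" "K' \<subseteq> V \<inter> near_rationals n" "emeasure \<nu> (- K') = 0" "sq_energy \<nu> < ennreal B"
proof -
  interpret \<mu>: prob_space \<mu> by fact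
  have sets [measurable_cong]: "sets \<mu> = sets borel" and D0: "0 \<le> D" using D by (auto simp: density_bounded_by_def)
  define I where "I = enn2real (sq_energy \<mu>)"
  have I: "sq_energy \<mu> = ennreal I" "0 \<le> I"
    using energy by (auto simp: I_def intro!: ennreal_enn2real[symmetric] less_trans[OF energy])
  have IB: "I < B" using energy I by (simp add: ennreal_less_iff)
  define m where "m = (I + B) / 2"
  have m: "I < m" "m < B" using IB by (auto simp: m_def)
  obtain \<beta> where \<beta>: "0 < \<beta>" "(1 + \<beta>)\<^sup>2 * I < m"
  proof -
    have "((\<lambda>\<beta>. (1 + \<beta>)\<^sup>2 * I) \<longlongrightarrow> (1 + 0)\<^sup>2 * I) (at_right 0)" by (intro tendsto_intros)
    then have "((\<lambda>\<beta>. (1 + \<beta>)\<^sup>2 * I) \<longlongrightarrow> I) (at_right 0)" by simp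
    then have "\<forall>\<^sub>F \<beta> in at_right 0. (1 + \<beta>)\<^sup>2 * I < m" using m(1) by (rule order_tendstoD)
    moreover have "\<forall>\<^sub>F \<beta> in at_right 0. (0::real) < \<beta>" by (simp add: eventually_at_filter)
    ultimately have "\<forall>\<^sub>F \<beta> in at_right 0. 0 < \<beta> \<and> (1 + \<beta>)\<^sup>2 * I < m"
      by (rule eventually_conj[rotated])
    then show ?thesis using that eventually_happens'[OF trivial_limit_at_right_real] by blast
  qed
  have eb: "exp (- \<beta>) < 1" using \<beta>(1) by simp
  obtain M :: nat where M: "0 < M" "16 * (real n)\<^sup>2 * D / M < B - m"
  proof -
    have "(\<lambda>M::nat. 16 * (real n)\<^sup>2 * D / M) \<longlonglongrightarrow> 0" by real_asymp
    then have "\<forall>\<^sub>F M::nat in sequentially. 16 * (real n)\<^sup>2 * D / M < B - m" using m by (intro order_tendstoD) auto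
    moreover have "\<forall>\<^sub>F M::nat in sequentially. (0::nat) < M" by (rule eventually_gt_at_top)
    ultimately have "\<forall>\<^sub>F M::nat in sequentially. (0::nat) < M \<and> 16 * (real n)\<^sup>2 * D / M < B - m"
      by (rule eventually_conj[rotated])
    then show ?thesis using that eventually_happens'[OF sequentially_bot] by blast
  qed
  obtain \<rho> where \<rho>: "0 < \<rho>" "(\<Union>x\<in>K. cball x \<rho>) \<subseteq> V"
    using compact_subset_open_imp_cball_epsilon_subset[OF K(1-3)] .
  define L where "L Q = ln (8 * (2 ^ M * real Q)\<^sup>2)" for Q :: nat
  define err where "err Q = (L Q)\<^sup>2 / sqrt Q * (2 * D) + (130 + 4 * (L Q)\<^sup>2) / Q * (2 * D) + 16 * (real n)\<^sup>2 * D / M" for Q :: nat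
  obtain Q :: nat where Q: "1 \<le> Q" "2 / real Q \<le> \<rho>" "4 * (1 / real Q) \<le> (1 - exp (- \<beta>)) * (1 / sqrt Q)" "err Q < B - m"
  proof -
    have "(\<lambda>Q. (L Q)\<^sup>2 / sqrt Q) \<longlonglongrightarrow> 0"
      unfolding L_def using zero_less_power[of "2::real" M] by real_asymp
    moreover have "(\<lambda>Q. (130 + 4 * (L Q)\<^sup>2) / Q) \<longlonglongrightarrow> 0"
      unfolding L_def using zero_less_power[of "2::real" M] by real_asymp
    ultimately have "err \<longlonglongrightarrow> 0 * (2 * D) + 0 * (2 * D) + 16 * (real n)\<^sup>2 * D / M"
      unfolding err_def by (intro tendsto_intros)
    then have 1: "\<forall>\<^sub>F Q in sequentially. err Q < B - m" using M(2) by (intro order_tendstoD) auto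
    have 2: "\<forall>\<^sub>F Q::nat in sequentially. 4 * (1 / real Q) \<le> (1 - exp (- \<beta>)) * (1 / sqrt Q)"
      using eb by real_asymp
    have 3: "\<forall>\<^sub>F Q::nat in sequentially. 2 / real Q \<le> \<rho>" using \<rho>(1) by real_asymp
    have 4: "\<forall>\<^sub>F Q::nat in sequentially. (1::nat) \<le> Q" by (rule eventually_ge_at_top)
    have "\<forall>\<^sub>F Q::nat in sequentially. (1::nat) \<le> Q \<and> 2 / real Q \<le> \<rho> \<and>
        4 * (1 / real Q) \<le> (1 - exp (- \<beta>)) * (1 / sqrt Q) \<and> err Q < B - m"
      by (intro eventually_conj 1 2 3 4)
    then show ?thesis using that eventually_happens'[OF sequentially_bot] by blast
  qed
  \<comment> \<open>bounds all denominators that occur, so that different fractions are at least \<open>1 / W\<^sup>2\<close> apart\<close>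
  define W where "W = 2 ^ M * real Q"
  have QW: "real Q \<le> W" "1 \<le> W" using Q(1) mult_mono[of 1 "2 ^ M" "1::real" "real Q"]
    by (auto simp: W_def)
  have LQ: "L Q = ln (8 * W\<^sup>2)" by (simp add: L_def W_def)
  have L1: "1 \<le> L Q"
  proof -
    have "exp 1 \<le> (3::real)" by (rule exp_le)
    also have "3 \<le> 8 * W\<^sup>2" using one_le_power[OF QW(2), of 2] by linarith
    finally show ?thesis unfolding LQ using QW by (subst ln_ge_iff) auto
  qed
  define \<Omega> where "\<Omega> = random_scale M \<mu>"
  interpret \<Omega>: prob_space \<Omega> unfolding \<Omega>_def using \<mu>.prob_space_axioms by (rule prob_space_random_scale)
  interpret U: prob_space unif01 by (rule prob_space_unif01)
  interpret P: pair_prob_space \<Omega> unif01 ..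
  have sndO [measurable]: "snd \<in> borel_measurable \<Omega>"
    unfolding \<Omega>_def random_scale_def by measurable
  define A where "A = random_dirichlet_pair M Q"
  have A [measurable]: "A \<in> \<Omega> \<rightarrow>\<^sub>M count_space UNIV"
    unfolding A_def \<Omega>_def by (rule measurable_random_dirichlet_pair[OF sets])
  define c where "c = (\<lambda>(p::int, q::int). real_of_int p / real_of_int q)"
  \<comment> \<open>the first entry puts the interval into \<^const>\<open>near_rationals\<close>; the second keeps intervals
      about different fractions apart, also for small \<open>q\<close>, where the first is large\<close>
  define R where "R = (\<lambda>(p::int, q::int). min (exp (- (real n * real_of_int q))) (1 / (4 * W\<^sup>2)) / 2)"
  have Aprop: "coprime p q" "0 < q" "real_of_int q \<le> W" "\<bar>x - c (p, q)\<bar> \<le> 1 / Q"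
    if "A (j, x) = (p, q)" for j x p q
  proof -
    let ?N = "2 ^ min j M * Q"
    have N: "0 < ?N" using Q(1) by simp
    have d: "dirichlet_pair ?N x = (p, q)" using that by (simp add: A_def random_dirichlet_pair_def)
    show "coprime p q" using dirichlet_pair[OF N, of x] d by (simp add: is_dirichlet_pair_def)
    note close = dirichlet_pair_close[OF N d]
    show q: "0 < q" by (rule close)
    have "real_of_int q \<le> real_of_int (int ?N)" using close(2) by (simp only: of_int_le_iff)
    also have "\<dots> \<le> W" unfolding W_def by (simp add: mult_right_mono power_increasing)
    finally show "real_of_int q \<le> W" .
    have "real Q \<le> real_of_int q * real ?N"
    proof -
      have "1 * (1 * real Q) \<le> real_of_int q * (2 ^ min j M * real Q)"
        using q by (intro mult_mono) auto
      then show ?thesis by simp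
    qed
    then have "1 / (real_of_int q * real ?N) \<le> 1 / real Q" using Q(1) q by (intro divide_left_mono mult_pos_pos) auto
    then show "\<bar>x - c (p, q)\<bar> \<le> 1 / Q" using close(3) by (simp add: c_def)
  qed
  have R_pos: "0 < R a" for a using QW by (auto simp: R_def split: prod.split)
  have R_le: "R a \<le> 1 / (8 * W\<^sup>2)" for a by (cases a) (simp add: R_def min_def)
  have W2: "W \<le> W\<^sup>2" "1 \<le> W\<^sup>2"
    using mult_left_mono[of 1 W W] one_le_power[of W 2] QW(2) by (auto simp: power2_eq_square)
  have R_le': "R a \<le> 1 / Q" "R a \<le> 1" for a
  proof -
    have "1 / (8 * W\<^sup>2) \<le> 1 / Q" "1 / (8 * W\<^sup>2) \<le> 1 / 1"
      using QW W2 Q(1) by (intro frac_le; simp)+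
    then show "R a \<le> 1 / Q" "R a \<le> 1" using R_le[of a] by linarith+
  qed
  have lnR: "(ln (R (p, q)))\<^sup>2 \<le> 2 * (real n * q)\<^sup>2 + 2 * (L Q)\<^sup>2" if "0 < q" for p q :: int
  proof -
    have L_split: "ln (4 * W\<^sup>2) + ln 2 = L Q" 
    proof -
      have "ln (4 * W\<^sup>2 * 2) = ln (4 * W\<^sup>2) + ln 2" using W2 by (intro ln_mult_pos) linarith+
      then show ?thesis unfolding LQ by simp
    qed
    have "0 < 4 * W\<^sup>2" using W2 by linarith
    then have "1 / (4 * W\<^sup>2) = exp (- ln (4 * W\<^sup>2))"
      by (simp only: exp_minus exp_ln inverse_eq_divide)
    then have eq: "R (p, q) = exp (- max (real n * q) (ln (4 * W\<^sup>2))) / 2"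
      unfolding R_def prod.case by (simp only: min_def max_def exp_le_cancel_iff neg_le_iff_le) simp
    have "- ln (R (p, q)) = max (real n * q) (ln (4 * W\<^sup>2)) + ln 2"
      unfolding eq by (simp add: ln_div)
    also have "\<dots> \<le> real n * q + (ln (4 * W\<^sup>2) + ln 2)"
    proof -
      have "0 \<le> real n * q" using that by simp
      moreover have "0 \<le> ln (4 * W\<^sup>2)" using W2 by (intro ln_ge_zero) linarith
      ultimately show ?thesis by simp
    qed
    finally have "- ln (R (p, q)) \<le> real n * q + L Q" unfolding L_split .
    moreover have "0 \<le> - ln (R (p, q))" using R_pos R_le' by simp
    ultimately have "(- ln (R (p, q)))\<^sup>2 \<le> (real n * q + L Q)\<^sup>2" by (intro power_mono)
    also have "\<dots> \<le> 2 * (real n * q)\<^sup>2 + 2 * (L Q)\<^sup>2"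
      using sum_squares_bound[of "real n * q" "L Q"] by (simp only: power2_sum)
    finally show ?thesis by simp
  qed
  define Y where "Y = (\<lambda>(\<omega>, u). c (A \<omega>) + R (A \<omega>) * u)"
  define \<nu> where "\<nu> = distr (\<Omega> \<Otimes>\<^sub>M unif01) borel Y"
  have [measurable]: "(\<lambda>\<omega>. c (A \<omega>)) \<in> borel_measurable \<Omega>" "(\<lambda>\<omega>. R (A \<omega>)) \<in> borel_measurable \<Omega>"
    by (rule measurable_compose[OF A]; simp)+
  have Y [measurable]: "Y \<in> borel_measurable (\<Omega> \<Otimes>\<^sub>M unif01)" unfolding Y_def by measurable
  have "sq_energy \<nu> \<le> ennreal ((1 + \<beta>)\<^sup>2) * sq_energy (distr \<Omega> borel snd)
      + ennreal ((L Q)\<^sup>2) * ennreal (2 * D / sqrt Q) + ennreal ((130 + 4 * (L Q)\<^sup>2) / Q * (2 * D) + 16 * (real n)\<^sup>2 * D / M)"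
    unfolding \<nu>_def Y_def
  proof (rule energy_of_discretised_measure[OF \<Omega>.prob_space_axioms sndO A, where t = "1 / sqrt Q" and h = "1 / Q"])
    fix x
    have "{\<omega> \<in> space \<Omega>. \<bar>x - snd \<omega>\<bar> < 1 / sqrt Q} = snd -` {y. \<bar>x - y\<bar> < 1 / sqrt Q} \<inter> space \<Omega>" by auto
    then have "emeasure \<Omega> {\<omega> \<in> space \<Omega>. \<bar>x - snd \<omega>\<bar> < 1 / sqrt Q}
        = emeasure (distr \<Omega> borel snd) {y. \<bar>x - y\<bar> < 1 / sqrt Q}" by (subst emeasure_distr) auto
    also have "\<dots> = emeasure \<mu> {y. \<bar>x - y\<bar> < 1 / sqrt Q}"
      unfolding \<Omega>_def by (simp add: distr_snd_random_scale[OF \<mu>.prob_space_axioms sets])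
    also have "{y. \<bar>x - y\<bar> < 1 / sqrt Q} = {x - 1 / sqrt Q<..<x + 1 / sqrt Q}" by auto
    also have "emeasure \<mu> \<dots> \<le> ennreal D * emeasure lborel {x - 1 / sqrt Q<..<x + 1 / sqrt Q}"
      by (rule emeasure_density_bounded_le[OF D]) simp
    also have "\<dots> = ennreal (2 * D / sqrt Q)" using D0 by (simp add: ennreal_mult'[symmetric] mult.commute)
    finally show "emeasure \<Omega> {\<omega> \<in> space \<Omega>. \<bar>x - snd \<omega>\<bar> < 1 / sqrt Q} \<le> ennreal (2 * D / sqrt Q)" .
  next
    fix \<omega> :: "nat \<times> real"
    obtain j x where \<omega>: "\<omega> = (j, x)" by (cases \<omega>)
    obtain p q where pq: "A \<omega> = (p, q)" by (cases "A \<omega>")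
    show "\<bar>snd \<omega> - c (A \<omega>)\<bar> \<le> 1 / Q" using Aprop(4)[of j x p q] pq \<omega> by simp
    show "0 < R (A \<omega>) \<and> R (A \<omega>) \<le> 1 / Q \<and> R (A \<omega>) \<le> 1" using R_pos R_le' by simp
    have q: "0 < q" using Aprop(2)[of j x p q] pq \<omega> by simp
    then have q1: "1 \<le> real_of_int q" by linarith
    let ?m = "emeasure \<Omega> {\<omega>' \<in> space \<Omega>. A \<omega>' = A \<omega>}"
    have "?m * ennreal (130 + 2 * (ln (R (A \<omega>)))\<^sup>2) \<le> ?m * ennreal ((130 + 4 * (L Q)\<^sup>2) + 4 * (real n * q)\<^sup>2)"
      using lnR[OF q, of p] pq by (intro mult_left_mono ennreal_leI) auto
    also have "\<dots> = ?m * ennreal (130 + 4 * (L Q)\<^sup>2) + ?m * ennreal (4 * (real n * q)\<^sup>2)"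
      by (subst ennreal_plus) (auto simp: distrib_left simp del: ennreal_plus)
    also have "\<dots> \<le> ennreal (2 * D / Q) * ennreal (130 + 4 * (L Q)\<^sup>2)
        + ennreal (4 * D / (M * (real_of_int q)\<^sup>2)) * ennreal (4 * (real n * q)\<^sup>2)"
      unfolding A_def \<Omega>_def pq[unfolded A_def] using emeasure_random_dirichlet_pair_le[OF D \<mu>.prob_space_axioms M(1) _ q, of Q p] Q(1)
      by (intro add_mono mult_right_mono) auto
    also have "\<dots> = ennreal (2 * D / Q * (130 + 4 * (L Q)\<^sup>2) + 4 * D / (M * (real_of_int q)\<^sup>2) * (4 * (real n * q)\<^sup>2))"
      using D0 by (simp add: ennreal_mult'[symmetric] flip: ennreal_plus)
    also have "2 * D / Q * (130 + 4 * (L Q)\<^sup>2) + 4 * D / (M * (real_of_int q)\<^sup>2) * (4 * (real n * q)\<^sup>2)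
        = (130 + 4 * (L Q)\<^sup>2) / Q * (2 * D) + 16 * (real n)\<^sup>2 * D / M"
      using q1 by (simp add: power_mult_distrib) (simp add: mult_ac)
    finally show "?m * ennreal (130 + 2 * (ln (R (A \<omega>)))\<^sup>2)
        \<le> ennreal ((130 + 4 * (L Q)\<^sup>2) / Q * (2 * D) + 16 * (real n)\<^sup>2 * D / M)" .
    fix \<omega>' :: "nat \<times> real" assume ne: "A \<omega> \<noteq> A \<omega>'"
    obtain j' x' where \<omega>': "\<omega>' = (j', x')" by (cases \<omega>')
    obtain p' q' where pq': "A \<omega>' = (p', q')" by (cases "A \<omega>'")
    note a = Aprop[of j x p q, folded \<omega>, OF pq] and a' = Aprop[of j' x' p' q', folded \<omega>', OF pq']
    have "1 / W\<^sup>2 \<le> 1 / (real_of_int q * real_of_int q')"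
      unfolding power2_eq_square using a a' by (intro divide_left_mono mult_mono) auto
    also have "\<dots> \<le> \<bar>c (A \<omega>) - c (A \<omega>')\<bar>"
      using coprime_fractions_apart[of p q p' q'] a a' ne pq pq' by (simp add: c_def)
    finally have "1 / W\<^sup>2 \<le> \<bar>c (A \<omega>) - c (A \<omega>')\<bar>" .
    moreover have "exp (- L Q) = 1 / (8 * W\<^sup>2)"
      unfolding LQ using QW by (simp add: exp_minus inverse_eq_divide)
    moreover have "3 * (1 / (8 * W\<^sup>2)) \<le> 1 / W\<^sup>2"
    proof -
      have "0 \<le> 1 / W\<^sup>2" "3 * (1 / (8 * W\<^sup>2)) = 3 / 8 * (1 / W\<^sup>2)" by simp_all
      then show ?thesis by linarith
    qed
    ultimately show "R (A \<omega>) + R (A \<omega>') + exp (- L Q) \<le> \<bar>c (A \<omega>) - c (A \<omega>')\<bar>"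
      using R_le[of "A \<omega>"] R_le[of "A \<omega>'"] by linarith
  qed (use \<beta> Q L1 in auto)
  also have "sq_energy (distr \<Omega> borel snd) = ennreal I"
    unfolding \<Omega>_def by (simp add: distr_snd_random_scale[OF \<mu>.prob_space_axioms sets] I)
  also have "ennreal ((1 + \<beta>)\<^sup>2) * ennreal I
      + ennreal ((L Q)\<^sup>2) * ennreal (2 * D / sqrt Q) + ennreal ((130 + 4 * (L Q)\<^sup>2) / Q * (2 * D) + 16 * (real n)\<^sup>2 * D / M)
      = ennreal ((1 + \<beta>)\<^sup>2 * I + err Q)"
    using D0 I(2) by (simp add: err_def ennreal_mult'[symmetric] add.assoc flip: ennreal_plus)
  also have "\<dots> < ennreal B" using \<beta>(2) Q(4) m I(2) by (intro ennreal_lessI) auto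
  finally have "sq_energy \<nu> < ennreal B" .
  moreover have "prob_space \<nu>" unfolding \<nu>_def by (rule P.P.prob_space_distr) (rule Y)
  moreover have "density_bounded_by (1 / (min (exp (- (real n * W))) (1 / (4 * W\<^sup>2)) / 2)) \<nu>"
    unfolding \<nu>_def Y_def
  proof (rule density_bounded_smoothing[OF \<Omega>.prob_space_axioms])
    fix \<omega> :: "nat \<times> real" assume "\<omega> \<in> space \<Omega>"
    obtain j x where \<omega>: "\<omega> = (j, x)" by (cases \<omega>)
    obtain p q where pq: "A \<omega> = (p, q)" by (cases "A \<omega>")
    have "real n * real_of_int q \<le> real n * W" using Aprop(3)[of j x p q] pq \<omega> by (intro mult_left_mono) auto
    then have "exp (- (real n * W)) \<le> exp (- (real n * real_of_int q))" by simp
    then show "min (exp (- (real n * W))) (1 / (4 * W\<^sup>2)) / 2 \<le> R (A \<omega>)"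
      unfolding pq R_def prod.case by (intro divide_right_mono min.mono) auto
  qed (use QW in auto)
  moreover
  define F where "F = {a. \<exists>j. \<exists>x\<in>K. a = A (j, x)}"
  define K' where "K' = (\<Union>a\<in>F. {c a..c a + R a})"
  have "finite F"
  proof -
    obtain b where b: "\<And>x. x \<in> K \<Longrightarrow> \<bar>x\<bar> \<le> b"
      using compact_imp_bounded[OF K(1)] by (auto simp: bounded_iff)
    define z where "z = \<lceil>W * (b + 1)\<rceil>"
    have "F \<subseteq> {- z..z} \<times> {0..\<lceil>W\<rceil>}"
    proof
      fix a assume "a \<in> F"
      then obtain j x where jx: "x \<in> K" "a = A (j, x)" by (auto simp: F_def)
      obtain p q where a: "a = (p, q)" by (cases a)
      note pr = Aprop[of j x p q, folded jx(2), OF a]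
      have "1 / real Q \<le> 1" using Q(1) by simp
      then have "\<bar>real_of_int p / q\<bar> \<le> b + 1" using b[OF jx(1)] pr(4) by (simp add: c_def)
      then have "\<bar>real_of_int p\<bar> \<le> q * (b + 1)" using pr(2) by (simp add: abs_divide field_simps)
      also have "\<dots> \<le> W * (b + 1)" using pr(3) b[OF jx(1)] by (intro mult_right_mono) auto
      also have "\<dots> \<le> real_of_int z" unfolding z_def by (rule le_of_int_ceiling)
      finally have "\<bar>p\<bar> \<le> z" by linarith
      moreover have "q \<le> \<lceil>W\<rceil>" using pr(3) by linarith
      ultimately show "a \<in> {- z..z} \<times> {0..\<lceil>W\<rceil>}" using pr(2) a by auto
    qed
    then show ?thesis by (rule finite_subset) auto
  qed
  have "compact K'" unfolding K'_def using \<open>finite F\<close> by (intro compact_UN) auto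
  moreover have "K' \<subseteq> V \<inter> near_rationals n"
  proof
    fix y assume "y \<in> K'"
    then obtain j x where jx: "x \<in> K" "c (A (j, x)) \<le> y" "y \<le> c (A (j, x)) + R (A (j, x))"
      by (auto simp: K'_def F_def)
    obtain p q where pq: "A (j, x) = (p, q)" by (cases "A (j, x)")
    note pr = Aprop[OF pq]
    have "\<bar>x - y\<bar> \<le> 2 / real Q" using jx(2,3) pr(4) R_le'[of "A (j, x)"] unfolding pq by linarith
    then have "y \<in> cball x \<rho>" using Q(2) by (simp add: dist_real_def)
    then have "y \<in> V" using \<rho>(2) jx(1) by blast
    moreover have "R (p, q) < exp (- (real n * q))"
    proof -
      have half: "a / 2 < b" if "a \<le> b" "0 < b" for a b :: real using that by linarith
      show ?thesis unfolding R_def prod.case by (rule half) auto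
    qed
    then have "\<bar>y - p / q\<bar> < exp (- (real n * q))" using jx(2,3) unfolding pq by (simp add: c_def)
    then have "y \<in> near_rationals n" using pr(2) unfolding near_rationals_def by blast
    ultimately show "y \<in> V \<inter> near_rationals n" by blast
  qed
  moreover have "emeasure \<nu> (- K') = 0"
  proof -
    have [measurable]: "K' \<in> sets borel" using \<open>compact K'\<close> by (rule borel_compact)
    have "AE x in \<mu>. x \<in> K"
      by (rule AE_I[of _ _ "- K"]) (use K borel_compact[OF K(1)] sets in auto)
    then have "AE x in distr \<Omega> borel snd. x \<in> K"
      unfolding \<Omega>_def distr_snd_random_scale[OF \<mu>.prob_space_axioms sets] .
    then have "AE \<omega> in \<Omega>. snd \<omega> \<in> K"
      by (subst (asm) AE_distr_iff) (use borel_compact[OF K(1)] in auto)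
    then have "AE \<omega> in \<Omega>. AE u in unif01. Y (\<omega>, u) \<in> K'"
    proof eventually_elim
      case (elim \<omega>)
      have "A \<omega> \<in> F" unfolding F_def using elim by (cases \<omega>) auto
      show ?case using AE_unif01
      proof eventually_elim
        case (elim u)
        have "Y (\<omega>, u) \<in> {c (A \<omega>)..c (A \<omega>) + R (A \<omega>)}"
          using elim R_pos[of "A \<omega>"] mult_left_le[of u "R (A \<omega>)"] by (auto simp: Y_def)
        then show ?case unfolding K'_def using \<open>A \<omega> \<in> F\<close> by blast
      qed
    qed
    moreover have "{z \<in> space (\<Omega> \<Otimes>\<^sub>M unif01). Y z \<in> K'} \<in> sets (\<Omega> \<Otimes>\<^sub>M unif01)"
      using measurable_sets[OF Y \<open>K' \<in> sets borel\<close>] by (simp only: vimage_def Int_def mem_Collect_eq conj_commute)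
    ultimately have "AE z in \<Omega> \<Otimes>\<^sub>M unif01. Y z \<in> K'"
      by (intro P.AE_pair_measure)
    then have "AE y in \<nu>. y \<in> K'" unfolding \<nu>_def by (subst AE_distr_iff) auto
    then show ?thesis by (subst (asm) AE_iff_measurable[of "- K'"]) (auto simp: \<nu>_def)
  qed
  ultimately show ?thesis using that by blast
qed

section \<open>Passage to the limit\<close>

lemma open_near_rationals: "open (near_rationals n)"
proof -
  have "near_rationals n = (\<Union>p::int. \<Union>q\<in>{q::int. 0 < q}. ball (p / q) (exp (- (real n * q))))"
    by (simp add: near_rationals_def dist_real_def abs_minus_commute set_eq_iff)
  then show ?thesis by (simp only:) (intro open_UN ballI open_ball)
qed

text \<open>The kernel is continuous also at distance 0, where it is infinite.\<close>
lemma tendsto_radial_kernel_two: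
  assumes d: "d \<longlonglongrightarrow> l" and nonneg: "\<And>m::nat. 0 \<le> d m"
  shows "(\<lambda>m. radial_kernel 2 (d m)) \<longlonglongrightarrow> radial_kernel 2 l"
proof (cases "l = 0")
  case True
  have "(\<lambda>m. radial_kernel 2 (d m)) \<longlonglongrightarrow> top"
    unfolding tendsto_top_iff_ennreal
  proof (intro allI impI)
    fix c :: real assume c: "0 \<le> c"
    have "\<forall>\<^sub>F m in sequentially. d m < exp (- (c + 1))"
      using d True by (intro order_tendstoD) auto
    then show "\<forall>\<^sub>F m in sequentially. ennreal c < radial_kernel 2 (d m)"
    proof eventually_elim
      case (elim m)
      have "(1 + c)\<^sup>2 = c\<^sup>2 + 2 * c + 1" by (simp add: power2_sum)
      then have "c < (1 + c)\<^sup>2" using c zero_le_power2[of c] by linarith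
      then have "ennreal c < radial_kernel 2 (exp (- (c + 1)))"
        using c by (simp add: radial_kernel_two max_def ennreal_lessI)
      also have "\<dots> \<le> radial_kernel 2 (d m)"
        using elim nonneg by (intro radial_kernel_antimono) auto
      finally show ?case .
    qed
  qed
  then show ?thesis using True by (simp add: radial_kernel_def)
next
  case False
  have "0 \<le> l" using d nonneg by (intro LIMSEQ_le_const) auto
  then have l: "0 < l" using False by simp
  have "\<forall>\<^sub>F m in sequentially. 0 < d m" using d l by (rule order_tendstoD)
  then have "\<forall>\<^sub>F m in sequentially. ennreal ((max 1 (- ln (d m)))\<^sup>2) = radial_kernel 2 (d m)"
    by eventually_elim (simp add: radial_kernel_two)
  moreover have "(\<lambda>m. ennreal ((max 1 (- ln (d m)))\<^sup>2)) \<longlonglongrightarrow> ennreal ((max 1 (- ln l))\<^sup>2)"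
    using d l by (intro tendsto_intros tendsto_ennrealI) auto
  ultimately show ?thesis using l by (simp add: radial_kernel_two tendsto_cong)
qed

lemma sq_energy_lower_semicontinuous:
  assumes "prob_space \<Omega>" and [measurable]: "\<And>m. Ys m \<in> borel_measurable \<Omega>" "Y \<in> borel_measurable \<Omega>"
    and lim: "\<And>\<omega>. \<omega> \<in> space \<Omega> \<Longrightarrow> (\<lambda>m. Ys m \<omega>) \<longlonglongrightarrow> Y \<omega>"
    and bound: "\<And>m. sq_energy (distr \<Omega> borel (Ys m)) \<le> B"
  shows "sq_energy (distr \<Omega> borel Y) \<le> B"
proof -
  interpret prob_space \<Omega> by fact
  have eq: "sq_energy (distr \<Omega> borel X) = (\<integral>\<^sup>+ \<omega>. \<integral>\<^sup>+ \<omega>'. radial_kernel 2 \<bar>X \<omega> - X \<omega>'\<bar> \<partial>\<Omega> \<partial>\<Omega>)"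
    if [measurable]: "X \<in> borel_measurable \<Omega>" for X
  proof -
    have "(\<lambda>x. \<integral>\<^sup>+ \<omega>. radial_kernel 2 \<bar>x - X \<omega>\<bar> \<partial>\<Omega>) \<in> borel_measurable borel" by measurable
    then show ?thesis unfolding sq_energy_def by (simp add: nn_integral_distr)
  qed
  have "sq_energy (distr \<Omega> borel Y)
      = (\<integral>\<^sup>+ \<omega>. \<integral>\<^sup>+ \<omega>'. liminf (\<lambda>m. radial_kernel 2 \<bar>Ys m \<omega> - Ys m \<omega>'\<bar>) \<partial>\<Omega> \<partial>\<Omega>)"
    unfolding eq[OF assms(3)]
  proof (intro nn_integral_cong)
    fix \<omega> \<omega>' assume "\<omega> \<in> space \<Omega>" "\<omega>' \<in> space \<Omega>"
    then have "(\<lambda>m. radial_kernel 2 \<bar>Ys m \<omega> - Ys m \<omega>'\<bar>) \<longlonglongrightarrow> radial_kernel 2 \<bar>Y \<omega> - Y \<omega>'\<bar>"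
      by (intro tendsto_radial_kernel_two tendsto_intros lim) auto
    then show "radial_kernel 2 \<bar>Y \<omega> - Y \<omega>'\<bar> = liminf (\<lambda>m. radial_kernel 2 \<bar>Ys m \<omega> - Ys m \<omega>'\<bar>)"
      by (intro lim_imp_Liminf[symmetric]) auto
  qed
  also have "\<dots> \<le> (\<integral>\<^sup>+ \<omega>. liminf (\<lambda>m. \<integral>\<^sup>+ \<omega>'. radial_kernel 2 \<bar>Ys m \<omega> - Ys m \<omega>'\<bar> \<partial>\<Omega>) \<partial>\<Omega>)"
    by (intro nn_integral_mono nn_integral_liminf) auto
  also have "\<dots> \<le> liminf (\<lambda>m. \<integral>\<^sup>+ \<omega>. \<integral>\<^sup>+ \<omega>'. radial_kernel 2 \<bar>Ys m \<omega> - Ys m \<omega>'\<bar> \<partial>\<Omega> \<partial>\<Omega>)"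
    by (intro nn_integral_liminf) auto
  also have "\<dots> \<le> liminf (\<lambda>m::nat. B)"
    using bound by (intro Liminf_mono) (auto simp: eq)
  also have "\<dots> = B" by (rule Liminf_const) simp
  finally show ?thesis .
qed

lemma bounded_density_on_interval:
  assumes "a < (b::real)"
  obtains \<mu> D where "density_bounded_by D \<mu>" "prob_space \<mu>" "emeasure \<mu> (- {a..b}) = 0"
proof
  let ?\<mu> = "uniform_measure lborel {a..b}"
  have "emeasure ?\<mu> S = ennreal (1 / (b - a)) * emeasure lborel ({a..b} \<inter> S)" if "S \<in> sets borel" for S
    using assms that
    by (simp add: divide_ennreal_def inverse_ennreal mult.commute inverse_eq_divide)
  then show "density_bounded_by (1 / (b - a)) ?\<mu>"
    using assms by (auto simp: density_bounded_by_def intro!: mult_left_mono emeasure_mono)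
  show "prob_space ?\<mu>" using assms by (intro prob_space_uniform_measure) auto
  show "emeasure ?\<mu> (- {a..b}) = 0" by simp
qed

text \<open>The open sets \<open>V n\<close> record where the mass is allowed to be. Since the closure of each lies in the previous
  one and in the next neighbourhood of the rationals, a limit of points of the \<open>V n\<close> still lies in all of
  them; from open sets that are merely nested it could escape through the boundary.\<close>
theorem exists_finite_energy_measure_on_non_brjuno:
  assumes "a < (b::real)"
  obtains K \<mu> where "compact K" "K \<subseteq> non_brjuno \<inter> {a<..<b}"
    "sets \<mu> = sets borel" "prob_space \<mu>" "emeasure \<mu> (- K) = 0" "sq_energy \<mu> < \<infinity>"
proof -
  obtain a' b' where ab: "a < a'" "a' < b'" "b' < b" using assms dense by meson
  obtain \<mu>0 D0 where \<mu>0: "density_bounded_by D0 \<mu>0" "prob_space \<mu>0" "emeasure \<mu>0 (- {a'..b'}) = 0"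
    using bounded_density_on_interval[OF ab(2)] .
  define B where "B = 64 * D0 + 2"
  have D0: "0 \<le> D0" using \<mu>0(1) by (simp add: density_bounded_by_def)
  have B0: "sq_energy \<mu>0 < ennreal B"
  proof -
    interpret \<mu>0: prob_space \<mu>0 by (rule \<mu>0)
    have "sq_energy \<mu>0 \<le> (\<integral>\<^sup>+ x. ennreal (64 * D0 + 1) \<partial>\<mu>0)"
      unfolding sq_energy_def by (intro nn_integral_mono potential_le_of_density_bounded \<mu>0)
    also have "\<dots> = ennreal (64 * D0 + 1)" by (simp add: \<mu>0.emeasure_space_1)
    also have "\<dots> < ennreal B" using D0 unfolding B_def by (intro ennreal_lessI) auto
    finally show ?thesis .
  qed
  define good where "good = (\<lambda>(\<mu>, V). \<exists>D K. density_bounded_by D \<mu> \<and> prob_space \<mu> \<and> compact K \<and> open V \<and>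
     K \<subseteq> V \<and> V \<subseteq> {a<..<b} \<and> emeasure \<mu> (- K) = 0 \<and> sq_energy \<mu> < ennreal B)"
  have "\<exists>f. \<forall>n. good (f n) \<and> (\<lambda>(\<mu>::real measure, V) (\<mu>'::real measure, V'). closure V' \<subseteq> V \<inter> near_rationals n) (f n) (f (Suc n))"
  proof (rule dependent_nat_choice)
    have "good (\<mu>0, {a<..<b})"
      unfolding good_def prod.case using \<mu>0 B0 ab
      by (intro exI[of _ D0] exI[of _ "{a'..b'}"]) auto
    then show "\<exists>x. good x" by blast
  next
    fix x n assume "good x"
    obtain \<mu> V where x: "x = (\<mu>, V)" by (cases x)
    obtain D K where \<mu>: "density_bounded_by D \<mu>" "prob_space \<mu>" "compact K" "open V"
        "K \<subseteq> V" "emeasure \<mu> (- K) = 0" "sq_energy \<mu> < ennreal B" and V: "V \<subseteq> {a<..<b}"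
      using \<open>good x\<close> unfolding good_def x by blast
    obtain D' \<nu> K' where \<nu>: "density_bounded_by D' \<nu>" "prob_space \<nu>" "compact K'"
        "K' \<subseteq> V \<inter> near_rationals n" "emeasure \<nu> (- K') = 0" "sq_energy \<nu> < ennreal B"
      using exists_measure_near_rationals[OF \<mu>] .
    have "closed (- (V \<inter> near_rationals n))" by (intro closed_Compl open_Int \<mu>(4) open_near_rationals)
    moreover have "K' \<inter> - (V \<inter> near_rationals n) = {}" using \<nu>(4) by blast
    ultimately obtain U W where UW: "open U" "open W" "K' \<subseteq> U" "- (V \<inter> near_rationals n) \<subseteq> W" "U \<inter> W = {}"
      using separation_normal[OF compact_imp_closed[OF \<nu>(3)]] by metis
    have "closure U \<subseteq> - W" using UW by (intro closure_minimal) auto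
    then have cl: "closure U \<subseteq> V \<inter> near_rationals n" using UW(4) by blast
    then have "U \<subseteq> {a<..<b}" using V closure_subset[of U] by blast
    then have "good (\<nu>, U)" unfolding good_def prod.case using \<nu> UW by blast
    then show "\<exists>y. good y \<and> (\<lambda>(\<mu>::real measure, V) (\<mu>'::real measure, V'). closure V' \<subseteq> V \<inter> near_rationals n) x y"
      using cl unfolding x by (intro exI[of _ "(\<nu>, U)"]) auto
  qed
  then obtain f where f: "\<And>n. good (f n)" "\<And>n. closure (snd (f (Suc n))) \<subseteq> snd (f n) \<inter> near_rationals n"
    by (auto simp: case_prod_unfold)
  define \<mu> V where "\<mu> n = fst (f n)" and "V n = snd (f n)" for n
  have \<mu>: "sets (\<mu> n) = sets borel" "prob_space (\<mu> n)" "V n \<subseteq> {a<..<b}" "open (V n)"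
      "emeasure (\<mu> n) (- V n) = 0" "sq_energy (\<mu> n) < ennreal B" for n
  proof -
    obtain D K where *: "density_bounded_by D (\<mu> n)" "prob_space (\<mu> n)" "compact K" "open (V n)"
        "K \<subseteq> V n" "V n \<subseteq> {a<..<b}" "emeasure (\<mu> n) (- K) = 0" "sq_energy (\<mu> n) < ennreal B"
      using f(1)[of n] unfolding good_def \<mu>_def V_def case_prod_unfold by blast
    show sets: "sets (\<mu> n) = sets borel" using *(1) by (simp add: density_bounded_by_def)
    have "emeasure (\<mu> n) (- V n) \<le> emeasure (\<mu> n) (- K)"
      using *(5) borel_compact[OF *(3)] by (intro emeasure_mono) (auto simp: sets)
    then show "emeasure (\<mu> n) (- V n) = 0" using *(7) by simp
  qed (use f(1)[of n] in \<open>auto simp: good_def \<mu>_def V_def case_prod_unfold\<close>)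
  have cl: "closure (V (Suc n)) \<subseteq> V n \<inter> near_rationals n" for n using f(2) by (simp add: V_def)
  have mono: "V m \<subseteq> V n" if "n \<le> m" for m n
    using that
  proof (rule lift_Suc_antimono_le[rotated])
    show "V (Suc n) \<le> V n" for n using cl[of n] closure_subset[of "V (Suc n)"] by blast
  qed
  have AE_V: "AE x in \<mu> n. x \<in> V n" for n
    by (rule AE_I[of _ _ "- V n"]) (use \<mu>[of n] in auto)
  have real_dist: "real_distribution (\<mu> n)" for n
    using \<mu>[of n] by (simp add: real_distribution_def real_distribution_axioms_def)
  have "tight \<mu>"
    unfolding tight_def
  proof (intro conjI allI impI)
    fix \<epsilon> :: real assume "0 < \<epsilon>"
    have "Sigma_Algebra.measure (\<mu> n) {a<..b} = 1" for n
    proof -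
      interpret real_distribution "\<mu> n" by (rule real_dist)
      have "AE x in \<mu> n. x \<in> {a<..b}" using AE_V[of n] by eventually_elim (use \<mu>(3)[of n] in auto)
      then show ?thesis using prob_eq_1[of "{a<..b}"] by auto
    qed
    then show "\<exists>a b. a < b \<and> (\<forall>n. 1 - \<epsilon> < Sigma_Algebra.measure (\<mu> n) {a<..b})"
      using assms \<open>0 < \<epsilon>\<close> by (intro exI[of _ a] exI[of _ b]) auto
  qed (rule real_dist)
  from tight_imp_convergent_subsubsequence[OF this strict_mono_id] obtain r M
    where r: "strict_mono r" and M: "real_distribution M" and conv: "weak_conv_m (\<mu> \<circ> r) M" by auto
  have "real_distribution ((\<mu> \<circ> r) n)" for n using real_dist by simp
  from Skorohod[OF this M conv] obtain \<Omega> :: "real measure" and Ys Y where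
    Skorohod: "prob_space \<Omega> \<and> (\<forall>n. Ys n \<in> borel_measurable \<Omega>) \<and> (\<forall>n. distr \<Omega> borel (Ys n) = (\<mu> \<circ> r) n)
      \<and> Y \<in> \<Omega> \<rightarrow>\<^sub>M lborel \<and> distr \<Omega> borel Y = M \<and> (\<forall>x\<in>space \<Omega>. (\<lambda>n. Ys n x) \<longlonglongrightarrow> Y x)"
    by blast
  then have \<Omega>: "prob_space \<Omega>" "\<And>n. Ys n \<in> borel_measurable \<Omega>"
      "\<And>n. distr \<Omega> borel (Ys n) = \<mu> (r n)" "Y \<in> \<Omega> \<rightarrow>\<^sub>M lborel" "distr \<Omega> borel Y = M"
      "\<And>\<omega>. \<omega> \<in> space \<Omega> \<Longrightarrow> (\<lambda>n. Ys n \<omega>) \<longlonglongrightarrow> Y \<omega>"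
    by (simp_all only: o_def)
  have Y [measurable]: "Y \<in> borel_measurable \<Omega>" using \<Omega>(4) by simp
  note [measurable] = \<Omega>(2)
  define K where "K = (\<Inter>n. closure (V n))"
  have K_sub: "K \<subseteq> V n \<inter> near_rationals n" for n using cl[of n] by (auto simp: K_def)
  have "compact K"
  proof -
    have "closed K" by (auto simp: K_def)
    moreover have "bounded K" using K_sub[of 0] \<mu>(3)[of 0] 
      by (intro bounded_subset[OF bounded_closed_interval[of a b]]) force
    ultimately show ?thesis by (simp add: compact_eq_bounded_closed)
  qed
  moreover have "K \<subseteq> non_brjuno \<inter> {a<..<b}"
  proof
    fix x assume x: "x \<in> K"
    have "x \<in> non_brjuno"
      using K_sub x unfolding near_rationals_def
      by (intro super_exponential_approximation_imp_non_brjuno) blast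
    then show "x \<in> non_brjuno \<inter> {a<..<b}" using K_sub[of 0] \<mu>(3)[of 0] x by auto
  qed
  moreover have "sets M = sets borel" "prob_space M"
    using M by (auto simp: real_distribution_def real_distribution_axioms_def)
  moreover have "emeasure M (- K) = 0"
  proof -
    have Kb [measurable]: "K \<in> sets borel" using \<open>compact K\<close> by (rule borel_compact)
    have "AE \<omega> in \<Omega>. Ys m \<omega> \<in> V (r m)" for m
    proof -
      have "AE x in distr \<Omega> borel (Ys m). x \<in> V (r m)" unfolding \<Omega>(3) by (rule AE_V)
      then show ?thesis using \<mu>(4)[of "r m"] by (subst (asm) AE_distr_iff) auto
    qed
    then have "AE \<omega> in \<Omega>. \<forall>m. Ys m \<omega> \<in> V (r m)" by (simp add: AE_all_countable)
    then have "AE \<omega> in \<Omega>. Y \<omega> \<in> K"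
      using AE_space
    proof eventually_elim
      case (elim \<omega>)
      have "Y \<omega> \<in> closure (V n)" for n
      proof (rule Lim_in_closed_set[OF closed_closure _ sequentially_bot \<Omega>(6)[OF elim(2)]])
        have "Ys m \<omega> \<in> closure (V n)" if "n \<le> m" for m
        proof -
          have "n \<le> r m" using that seq_suble[OF r, of m] by linarith
          then show ?thesis using elim(1) mono closure_subset by blast
        qed
        then show "\<forall>\<^sub>F m in sequentially. Ys m \<omega> \<in> closure (V n)"
          by (auto simp: eventually_sequentially)
      qed
      then show ?case by (simp add: K_def)
    qed
    then have "AE y in M. y \<in> K" unfolding \<Omega>(5)[symmetric] by (subst AE_distr_iff) auto
    then show ?thesis by (subst (asm) AE_iff_measurable[of "- K"]) (auto simp flip: \<Omega>(5))
  qed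
  moreover have "sq_energy M < \<infinity>"
  proof -
    have "sq_energy M \<le> ennreal B"
      unfolding \<Omega>(5)[symmetric]
    proof (rule sq_energy_lower_semicontinuous[OF \<Omega>(1,2) Y \<Omega>(6)])
      show "sq_energy (distr \<Omega> borel (Ys m)) \<le> ennreal B" for m
        unfolding \<Omega>(3) using \<mu>(6) by (rule less_imp_le)
    qed
    then show ?thesis by (simp add: le_less_trans)
  qed
  ultimately show ?thesis using that by blast
qed

section \<open>Hausdorff measure and capacity of the non-Brjuno numbers\<close>

lemma non_brjuno_interval_carries_finite_energy:
  fixes J :: "real set"
  assumes "is_interval J" and "\<exists>a\<in>J. \<exists>b\<in>J. a < b"
  obtains K \<mu> where "compact K" "K \<subseteq> complex_of_real ` (non_brjuno \<inter> J)"
    "\<mu> \<in> prob_measures_on K" "log_energy 2 \<mu> < \<infinity>"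
proof -
  obtain a b where ab: "a \<in> J" "b \<in> J" "a < b" using assms(2) by blast
  then have J: "{a<..<b} \<subseteq> J" using assms(1) by (meson greaterThanLessThan_iff less_imp_le mem_is_interval_1_I subsetI)
  obtain K0 \<mu> where K0: "compact K0" "K0 \<subseteq> non_brjuno \<inter> {a<..<b}"
    and sets [measurable_cong]: "sets \<mu> = sets borel" and \<mu>: "prob_space \<mu>" "emeasure \<mu> (- K0) = 0" "sq_energy \<mu> < \<infinity>"
    using exists_finite_energy_measure_on_non_brjuno[OF ab(3)] .
  interpret prob_space \<mu> by fact
  have sp: "space \<mu> = UNIV" using sets_eq_imp_space_eq[OF sets] by simp
  let ?K = "complex_of_real ` K0" and ?\<mu> = "distr \<mu> borel complex_of_real"
  have "compact ?K" using K0(1) by (intro compact_continuous_image continuous_intros)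
  moreover have "?K \<subseteq> complex_of_real ` (non_brjuno \<inter> J)" using K0(2) J by blast
  moreover have "?\<mu> \<in> prob_measures_on ?K"
  proof -
    have "emeasure ?\<mu> (- ?K) = emeasure \<mu> (complex_of_real -` (- ?K))"
      using borel_compact[OF \<open>compact ?K\<close>] by (subst emeasure_distr) (auto simp: sp)
    also have "complex_of_real -` (- ?K) = - K0" by auto
    finally show ?thesis using \<mu>(2) prob_space_distr[of complex_of_real borel]
      by (simp add: prob_measures_on_def)
  qed
  moreover have "log_energy 2 ?\<mu> < \<infinity>"
  proof -
    have k: "log_kernel 2 (complex_of_real y) (complex_of_real x) = radial_kernel 2 \<bar>x - y\<bar>" for x y
      by (simp add: log_kernel_eq_radial abs_minus_commute flip: of_real_diff)
    have [measurable]: "(\<lambda>z. log_kernel 2 z w) \<in> borel_measurable borel" for w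
      unfolding log_kernel_eq_radial by measurable
    have "(\<lambda>w. \<integral>\<^sup>+ x. log_kernel 2 (complex_of_real x) w \<partial>\<mu>) \<in> borel_measurable borel"
      unfolding log_kernel_eq_radial by measurable
    then have "log_energy 2 ?\<mu> = sq_energy \<mu>"
      unfolding log_energy_def sq_energy_def by (simp add: nn_integral_distr k)
    then show ?thesis using \<mu>(3) by simp
  qed
  ultimately show ?thesis using that by blast
qed

lemma log_energy_mono_exponent: "s \<le> s' \<Longrightarrow> log_energy s \<mu> \<le> log_energy s' \<mu>"
  unfolding log_energy_def log_kernel_eq_radial
  by (intro nn_integral_mono radial_kernel_mono_exponent)

lemma log_cap_pos:
  assumes "compact K" "K \<subseteq> E" "\<mu> \<in> prob_measures_on K" "log_energy s \<mu> < \<infinity>"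
  shows "0 < log_cap s E"
proof -
  have "(INF \<mu> \<in> prob_measures_on K. log_energy s \<mu>) \<le> log_energy s \<mu>" using assms(3) by (rule INF_lower)
  also have "\<dots> < top" using assms(4) by simp
  finally have "(INF \<mu> \<in> prob_measures_on K. log_energy s \<mu>) < top" .
  then have "(INF \<mu> \<in> prob_measures_on K. log_energy s \<mu>) \<noteq> top" by (rule less_imp_neq)
  then have "0 < log_cap_compact s K" unfolding log_cap_compact_def ennreal_inverse_positive .
  also have "\<dots> \<le> log_cap s E" unfolding log_cap_def using assms by (intro SUP_upper) auto
  finally show ?thesis .
qed

text \<open>A compact subset of positive capacity would carry a measure of finite energy and so force infinite
  Hausdorff measure.\<close>
lemma log_cap_eq_0:
  assumes E: "hausdorff_measure (log_gauge s) E \<noteq> \<infinity>" and s: "0 < s"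
  shows "log_cap s (complex_of_real ` E) = 0"
proof -
  have "log_cap_compact s K = 0" if K: "compact K" "K \<subseteq> complex_of_real ` E" for K
  proof -
    have "log_energy s \<mu> = \<infinity>" if "\<mu> \<in> prob_measures_on K" for \<mu>
    proof (rule ccontr)
      assume "log_energy s \<mu> \<noteq> \<infinity>"
      then have "hausdorff_measure (log_gauge s) E = \<infinity>"
        using that K s borel_compact[OF K(1)]
        by (intro hausdorff_measure_infinite_of_finite_energy[where \<mu> = \<mu> and K = K])
           (auto simp: prob_measures_on_def top.not_eq_extremum)
      then show False using E by contradiction
    qed
    then have "(INF \<mu> \<in> prob_measures_on K. log_energy s \<mu>) = top"
      by (intro top_le INF_greatest) simp
    then show ?thesis by (simp add: log_cap_compact_def)
  qed
  then show ?thesis unfolding log_cap_def by (auto intro!: antisym SUP_least)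
qed

text \<open>One measure of finite energy of exponent 2 serves all exponents up to 2, because the kernels increase
  with the exponent.\<close>
lemma hausdorff_measure_and_capacity_of_non_brjuno:
  fixes J :: "real set"
  assumes J: "is_interval J" "\<exists>a\<in>J. \<exists>b\<in>J. a < b"
  shows "0 < \<delta> \<Longrightarrow> \<delta> \<le> 2 \<Longrightarrow> hausdorff_measure (log_gauge \<delta>) (non_brjuno \<inter> J) = \<infinity>"
    and "0 < s \<Longrightarrow> s \<le> 2 \<Longrightarrow> 0 < log_cap s (complex_of_real ` (non_brjuno \<inter> J))"
    and "2 < s \<Longrightarrow> log_cap s (complex_of_real ` (non_brjuno \<inter> J)) = 0"
    and "cap_dim (complex_of_real ` (non_brjuno \<inter> J)) = 2"
proof -
  obtain K \<mu> where K: "compact K" "K \<subseteq> complex_of_real ` (non_brjuno \<inter> J)"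
    and \<mu>: "\<mu> \<in> prob_measures_on K" "log_energy 2 \<mu> < \<infinity>"
    using non_brjuno_interval_carries_finite_energy[OF J] .
  have fin: "log_energy s \<mu> < \<infinity>" if "s \<le> 2" for s
    using log_energy_mono_exponent[OF that] \<mu>(2) by (rule le_less_trans)
  show "hausdorff_measure (log_gauge \<delta>) (non_brjuno \<inter> J) = \<infinity>" if "0 < \<delta>" "\<delta> \<le> 2"
    using fin[OF that(2)] that \<mu>(1) K borel_compact[OF K(1)]
    by (intro hausdorff_measure_infinite_of_finite_energy[where \<mu> = \<mu> and K = K]) (auto simp: prob_measures_on_def)
  show pos: "0 < log_cap s (complex_of_real ` (non_brjuno \<inter> J))" if "0 < s" "s \<le> 2" for s
    using log_cap_pos[OF K \<mu>(1) fin[OF that(2)]] .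
  show zero: "log_cap s (complex_of_real ` (non_brjuno \<inter> J)) = 0" if "2 < s" for s
  proof -
    have "log_cap s (complex_of_real ` (non_brjuno \<inter> J)) \<le> log_cap s (complex_of_real ` non_brjuno)"
      unfolding log_cap_def by (intro SUP_subset_mono) auto
    also have "\<dots> = 0"
      using that by (intro log_cap_eq_0) (auto simp: hausdorff_measure_non_brjuno_eq_0)
    finally show ?thesis by simp
  qed
  show "cap_dim (complex_of_real ` (non_brjuno \<inter> J)) = 2"
    unfolding cap_dim_def
  proof (intro antisym SUP_least)
    fix s assume "s \<in> {s. 0 < s \<and> 0 < log_cap s (complex_of_real ` (non_brjuno \<inter> J))}"
    then have "s \<le> 2" using zero[of s] by force
    then have "ennreal s \<le> ennreal 2" by (rule ennreal_leI)
    then show "ennreal s \<le> 2" by simp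
  next
    have "ennreal 2 \<le> (SUP s \<in> {s. 0 < s \<and> 0 < log_cap s (complex_of_real ` (non_brjuno \<inter> J))}. ennreal s)"
      by (rule SUP_upper) (use pos[of 2] in simp)
    then show "2 \<le> (SUP s \<in> {s. 0 < s \<and> 0 < log_cap s (complex_of_real ` (non_brjuno \<inter> J))}. ennreal s)"
      by simp
  qed
qed

theorem theorem1p2:
  fixes J :: "real set"
  assumes "is_interval J" and "\<exists>a\<in>J. \<exists>b\<in>J. a < b"
  shows "(\<forall>\<delta>. 0 < \<delta> \<and> \<delta> \<le> 2 \<longrightarrow> hausdorff_measure (log_gauge \<delta>) (non_brjuno \<inter> J) = \<infinity>)
    \<and> (\<forall>\<delta>>2. hausdorff_measure (log_gauge \<delta>) non_brjuno = 0)
    \<and> (\<forall>s. 0 < s \<and> s \<le> 2 \<longrightarrow> log_cap s (complex_of_real ` (non_brjuno \<inter> J)) > 0)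
    \<and> (\<forall>s>2. log_cap s (complex_of_real ` (non_brjuno \<inter> J)) = 0)
    \<and> log_cap 2 (complex_of_real ` non_brjuno) > 0
    \<and> cap_dim (complex_of_real ` (non_brjuno \<inter> J)) = 2
    \<and> cap_dim (complex_of_real ` non_brjuno) = 2"
proof -
  have line: "is_interval (UNIV :: real set)" "\<exists>a\<in>(UNIV :: real set). \<exists>b\<in>UNIV. a < b"
    by (auto intro: gt_ex)
  note on_J = hausdorff_measure_and_capacity_of_non_brjuno[OF assms]
  note on_line = hausdorff_measure_and_capacity_of_non_brjuno[OF line, unfolded Int_UNIV_right]
  show ?thesis
    using on_J on_line(2)[of 2] on_line(4) hausdorff_measure_non_brjuno_eq_0 by auto
qed

end
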